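(* Let $V$ be a $\mathbb{Z}_2$-graded complex vector space of dimension $1|2$ with homogeneous basis $v_1,v_2,v_3$, where $v_1$ is even and $v_2,v_3$ are odd. Then the following $28$ elements of $\mathrm{Hom}(V\otimes V,V)$ are odd codifferentials, they are pairwise nonequivalent, and every nonzero odd codifferential $d\in \mathrm{Hom}(V\otimes V,V)$ is equivalent to exactly one of them: \begin{align*} d_1&=\psi^{13}_1-\psi^{31}_1+\psi^{11}_3+\psi^{22}_2-\psi^{33}_3\\ d_2&=\psi^{13}_1-\psi^{31}_1+\psi^{11}_3-\psi^{33}_3\\ d_3&=\psi^{22}_2+\psi^{33}_3-\psi^{12}_1\\ d_4&=\psi^{22}_2+\psi^{33}_3+\psi^{21}_1\\ d_5&=\psi^{22}_2+\psi^{33}_3+\psi^{21}_1-\psi^{13}_1\\ d_6&=\psi^{22}_2+\psi^{33}_3+\psi^{21}_1-\psi^{12}_1\\ d_7&=\psi^{22}_2+\psi^{33}_3\\ d_8&=\psi^{33}_3+\psi^{11}_2+\psi^{31}_1-\psi^{13}_1+\psi^{32}_2+\psi^{23}_2\\ d_9&=\psi^{33}_3+\psi^{11}_2\\ d_{10}&=\psi^{33}_3-\psi^{13}_1+\psi^{23}_2\\ d_{11}&=\psi^{33}_3+\psi^{31}_1+\psi^{32}_2\\ d_{12}&=\psi^{33}_3+\psi^{31}_1+\psi^{23}_2\\ d_{13}&=\psi^{33}_3-\psi^{13}_1+\psi^{32}_2\\ d_{14}&=\psi^{33}_3+\psi^{31}_1-\psi^{13}_1+\psi^{23}_2\\ d_{15}&=\psi^{33}_3+\psi^{31}_1-\psi^{13}_1+\psi^{32}_2\\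 d_{16}&=\psi^{33}_3+\psi^{23}_2\\ d_{17}&=\psi^{33}_3+\psi^{32}_2\\ d_{18}&=\psi^{33}_3-\psi^{13}_1+\psi^{23}_2+\psi^{32}_2\\ d_{19}&=\psi^{33}_3+\psi^{31}_1+\psi^{23}_2+\psi^{32}_2\\ d_{20}&=\psi^{33}_3+\psi^{23}_2+\psi^{32}_2\\ d_{21}&=\psi^{33}_3-\psi^{13}_1\\ d_{22}&=\psi^{33}_3+\psi^{31}_1\\ d_{23}&=\psi^{33}_3-\psi^{13}_1+\psi^{31}_1\\ d_{24}&=\psi^{33}_3-\psi^{13}_1+\psi^{31}_1+\psi^{23}_2+\psi^{32}_2\\ d_{25}&=\psi^{33}_3\\ d_{26}&=\psi^{11}_2+\psi^{33}_2\\ d_{27}&=\psi^{11}_2\\ d_{28}&=\psi^{33}_2 \end{align*} Equivalently, these codifferentials represent the isomorphism classes of nonzero $\mathbb{Z}_2$-graded associative algebra structures on a complex vector space of dimension $2|1$ (even part of dimension $2$, odd part of dimension $1$), each class exactly once.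
   Context: A $\mathbb{Z}_2$-graded space has dimension $p|q$ if its even part has dimension $p$ and its odd part has dimension $q$. Algebras are not assumed to be unital. For $i,j,k\in\{1,2,3\}$, $\psi^{ij}_k\in\mathrm{Hom}(V\otimes V,V)$ denotes the linear map with $\psi^{ij}_k(v_i\otimes v_j)=v_k$ that sends every other basis tensor $v_a\otimes v_b$ to $0$; the letter $\psi$ is used when this map is odd (parity reversing). An odd codifferential in $\mathrm{Hom}(V\otimes V,V)$ is an odd linear map $d:V\otimes V\to V$ whose extension to a coderivation of the tensor coalgebra of $V$ satisfies $[d,d]=0$. Explicitly, for all homogeneous $a,b,c\in V$, $$d(d(a\otimes b)\otimes c)+(-1)^{|a|}d(a\otimes d(b\otimes c))=0,$$ where $|a|\in\{0,1\}$ is the parity of $a$. Two odd codifferentials $d,d'$ are equivalent if there is an even (parity preserving) linear automorphism $g$ of $V$ with $d'=g^{-1}\circ d\circ(g\otimes g)$. If $A$ is a $\mathbb{Z}_2$-graded vector space, its parity reversion $\Pi A$ is the same vector space with the parities of homogeneous elements interchanged; let $\pi:A\to\Pi A$ be the identity map, regarded as an odd map. A $\mathbb{Z}_2$-graded associative algebra structure $m:A\otimes A\to A$ (an even map) corresponds to the odd codifferential $d=\pi\circ m\circ(\pi^{-1}\otimes\pi^{-1})$ on $\Pi A$, with the Koszul sign convention for tensor products of odd maps. If $A$ has dimension $2|1$, then $V=\Pi A$ has dimension $1|2$. Isomorphism of algebra structures on $A$ is by even linear automorphisms. *)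

theory Defs
  imports Complex_Main "HOL-Library.Z2" "HOL-Library.Function_Algebras"
begin

text \<open>
  A complex vector space is a whole type \<open>'v\<close> with scalar multiplication \<open>scale\<close>, as in
  \<^locale>\<open>vector_space\<close>; a grading is the family of its homogeneous parts, indexed by
  the two-element field \<^typ>\<open>bit\<close> (\<open>V 0\<close> even, \<open>V 1\<close> odd). Elements of
  \<open>Hom(V \<otimes> V, V)\<close> are bilinear maps in curried form, added and compared pointwise
  (\<^theory>\<open>HOL-Library.Function_Algebras\<close>), so \<open>d \<circ> (g \<otimes> g)\<close> is
  \<open>\<lambda>x y. d (g x) (g y)\<close> for even \<open>g\<close>.
\<close>

type_synonym 'v scalar_mult = "complex \<Rightarrow> 'v \<Rightarrow> 'v"
type_synonym 'v grading = "bit \<Rightarrow> 'v set"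
type_synonym 'v binop = "'v \<Rightarrow> 'v \<Rightarrow> 'v"

definition graded_space :: "'v::ab_group_add scalar_mult \<Rightarrow> 'v grading \<Rightarrow> bool" where
  "graded_space scale V \<longleftrightarrow>
     vector_space scale \<and>
     (\<forall>p. module.subspace scale (V p)) \<and>
     V 0 \<inter> V 1 = {0} \<and>
     (\<forall>x. \<exists>a\<in>V 0. \<exists>b\<in>V 1. x = a + b)"

definition is_basis :: "'v::ab_group_add scalar_mult \<Rightarrow> 'v set \<Rightarrow> 'v set \<Rightarrow> bool" where
  "is_basis scale S B \<longleftrightarrow> \<not> module.dependent scale B \<and> module.span scale B = S"

definition has_graded_dim ::
    "'v::ab_group_add scalar_mult \<Rightarrow> 'v grading \<Rightarrow> nat \<Rightarrow> nat \<Rightarrow> bool" where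
  "has_graded_dim scale V p q \<longleftrightarrow>
     (\<exists>B. is_basis scale (V 0) B \<and> finite B \<and> card B = p) \<and>
     (\<exists>B. is_basis scale (V 1) B \<and> finite B \<and> card B = q)"

definition parity_rev :: "'v grading \<Rightarrow> 'v grading" where
  "parity_rev V p = V (p + 1)"

definition homogeneous_basis_1_2 ::
    "'v::ab_group_add scalar_mult \<Rightarrow> 'v grading \<Rightarrow> (nat \<Rightarrow> 'v) \<Rightarrow> bool" where
  "homogeneous_basis_1_2 scale V v \<longleftrightarrow>
     inj_on v {1, 2, 3} \<and> is_basis scale UNIV (v ` {1, 2, 3}) \<and>
     v 1 \<in> V 0 \<and> v 2 \<in> V 1 \<and> v 3 \<in> V 1"

definition bilinear_op :: "'v::ab_group_add scalar_mult \<Rightarrow> 'v binop \<Rightarrow> bool" where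
  "bilinear_op scale d \<longleftrightarrow>
     (\<forall>x. Vector_Spaces.linear scale scale (\<lambda>y. d x y)) \<and>
     (\<forall>y. Vector_Spaces.linear scale scale (\<lambda>x. d x y))"

text \<open>\<open>op_of_parity V r d\<close>: the map \<open>d\<close> on \<open>V \<otimes> V\<close> is homogeneous of parity \<open>r\<close>.\<close>

definition op_of_parity :: "'v grading \<Rightarrow> bit \<Rightarrow> 'v binop \<Rightarrow> bool" where
  "op_of_parity V r d \<longleftrightarrow> (\<forall>p q. \<forall>a\<in>V p. \<forall>b\<in>V q. d a b \<in> V (p + q + r))"

definition parity_sign :: "bit \<Rightarrow> complex" where
  "parity_sign p = (if p = 0 then 1 else -1)"

text \<open>The last conjunct is \<open>[d,d] = 0\<close> for the coderivation extending \<open>d\<close>.\<close>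

definition odd_codifferential ::
    "'v::ab_group_add scalar_mult \<Rightarrow> 'v grading \<Rightarrow> 'v binop \<Rightarrow> bool" where
  "odd_codifferential scale V d \<longleftrightarrow>
     bilinear_op scale d \<and> op_of_parity V 1 d \<and>
     (\<forall>p q r. \<forall>a\<in>V p. \<forall>b\<in>V q. \<forall>c\<in>V r.
        d (d a b) c + scale (parity_sign p) (d a (d b c)) = 0)"

definition even_automorphism ::
    "'v::ab_group_add scalar_mult \<Rightarrow> 'v grading \<Rightarrow> ('v \<Rightarrow> 'v) \<Rightarrow> bool" where
  "even_automorphism scale V g \<longleftrightarrow>
     Vector_Spaces.linear scale scale g \<and> bij g \<and> (\<forall>p. g ` V p \<subseteq> V p)"

definition equivalent_codiff ::
    "'v::ab_group_add scalar_mult \<Rightarrow> 'v grading \<Rightarrow> 'v binop \<Rightarrow> 'v binop \<Rightarrow> bool" where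
  "equivalent_codiff scale V d d' \<longleftrightarrow>
     (\<exists>g. even_automorphism scale V g \<and> d' = (\<lambda>x y. inv g (d (g x) (g y))))"

definition psi ::
    "'v::ab_group_add scalar_mult \<Rightarrow> (nat \<Rightarrow> 'v) \<Rightarrow> nat \<Rightarrow> nat \<Rightarrow> nat \<Rightarrow> 'v binop" where
  "psi scale v i j k =
     (let coord = (\<lambda>x n. module.representation scale (v ` {1, 2, 3}) x (v n))
      in (\<lambda>x y. scale (coord x i * coord y j) (v k)))"

text \<open>In this list \<open>\<psi> i j k\<close> is \<open>\<psi>\<^sup>i\<^sup>j\<^sub>k\<close>.\<close>

definition codiff_list ::
    "'v::ab_group_add scalar_mult \<Rightarrow> (nat \<Rightarrow> 'v) \<Rightarrow> 'v binop list" where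
  "codiff_list scale v =
    (let \<psi> = psi scale v in
     [ \<psi> 1 3 1 - \<psi> 3 1 1 + \<psi> 1 1 3 + \<psi> 2 2 2 - \<psi> 3 3 3,
       \<psi> 1 3 1 - \<psi> 3 1 1 + \<psi> 1 1 3 - \<psi> 3 3 3,
       \<psi> 2 2 2 + \<psi> 3 3 3 - \<psi> 1 2 1,
       \<psi> 2 2 2 + \<psi> 3 3 3 + \<psi> 2 1 1,
       \<psi> 2 2 2 + \<psi> 3 3 3 + \<psi> 2 1 1 - \<psi> 1 3 1,
       \<psi> 2 2 2 + \<psi> 3 3 3 + \<psi> 2 1 1 - \<psi> 1 2 1,
       \<psi> 2 2 2 + \<psi> 3 3 3,
       \<psi> 3 3 3 + \<psi> 1 1 2 + \<psi> 3 1 1 - \<psi> 1 3 1 + \<psi> 3 2 2 + \<psi> 2 3 2,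
       \<psi> 3 3 3 + \<psi> 1 1 2,
       \<psi> 3 3 3 - \<psi> 1 3 1 + \<psi> 2 3 2,
       \<psi> 3 3 3 + \<psi> 3 1 1 + \<psi> 3 2 2,
       \<psi> 3 3 3 + \<psi> 3 1 1 + \<psi> 2 3 2,
       \<psi> 3 3 3 - \<psi> 1 3 1 + \<psi> 3 2 2,
       \<psi> 3 3 3 + \<psi> 3 1 1 - \<psi> 1 3 1 + \<psi> 2 3 2,
       \<psi> 3 3 3 + \<psi> 3 1 1 - \<psi> 1 3 1 + \<psi> 3 2 2,
       \<psi> 3 3 3 + \<psi> 2 3 2,
       \<psi> 3 3 3 + \<psi> 3 2 2,
       \<psi> 3 3 3 - \<psi> 1 3 1 + \<psi> 2 3 2 + \<psi> 3 2 2,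
       \<psi> 3 3 3 + \<psi> 3 1 1 + \<psi> 2 3 2 + \<psi> 3 2 2,
       \<psi> 3 3 3 + \<psi> 2 3 2 + \<psi> 3 2 2,
       \<psi> 3 3 3 - \<psi> 1 3 1,
       \<psi> 3 3 3 + \<psi> 3 1 1,
       \<psi> 3 3 3 - \<psi> 1 3 1 + \<psi> 3 1 1,
       \<psi> 3 3 3 - \<psi> 1 3 1 + \<psi> 3 1 1 + \<psi> 2 3 2 + \<psi> 3 2 2,
       \<psi> 3 3 3,
       \<psi> 1 1 2 + \<psi> 3 3 2,
       \<psi> 1 1 2,
       \<psi> 3 3 2 ])"

definition codiff ::
    "'v::ab_group_add scalar_mult \<Rightarrow> (nat \<Rightarrow> 'v) \<Rightarrow> nat \<Rightarrow> 'v binop" where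
  "codiff scale v n = codiff_list scale v ! (n - 1)"

definition graded_assoc_algebra ::
    "'v::ab_group_add scalar_mult \<Rightarrow> 'v grading \<Rightarrow> 'v binop \<Rightarrow> bool" where
  "graded_assoc_algebra scale A m \<longleftrightarrow>
     bilinear_op scale m \<and> op_of_parity A 0 m \<and>
     (\<forall>a b c. m (m a b) c = m a (m b c))"

definition isomorphic_algebra ::
    "'v::ab_group_add scalar_mult \<Rightarrow> 'v grading \<Rightarrow> 'v binop \<Rightarrow> 'v binop \<Rightarrow> bool" where
  "isomorphic_algebra scale A m m' \<longleftrightarrow>
     (\<exists>g. even_automorphism scale A g \<and> (\<forall>a b. g (m a b) = m' (g a) (g b)))"

text \<open>The component of \<open>x\<close> in \<open>V p\<close>; meaningful for a direct sum decomposition.\<close>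

definition component :: "'v::ab_group_add grading \<Rightarrow> bit \<Rightarrow> 'v \<Rightarrow> 'v" where
  "component V p x = (THE a. a \<in> V p \<and> x - a \<in> V (p + 1))"

text \<open>
  \<open>\<pi> \<circ> m \<circ> (\<pi>\<inverse> \<otimes> \<pi>\<inverse>)\<close> on \<open>\<Pi>A\<close>. Since \<open>\<pi>\<close> is the identity on vectors, the only
  effect is the Koszul sign of moving the second, odd, \<open>\<pi>\<inverse>\<close> past the first argument:
  the value at \<open>x \<otimes> y\<close>, for \<open>x\<close> of parity \<open>p\<close> in \<open>\<Pi>A\<close>, is \<open>(-1)\<^sup>p m x y\<close>.
\<close>

definition codiff_of_algebra ::
    "'v::ab_group_add grading \<Rightarrow> 'v binop \<Rightarrow> 'v binop" where
  "codiff_of_algebra A m =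
     (\<lambda>x y. m (component (parity_rev A) 0 x) y - m (component (parity_rev A) 1 x) y)"

end

theory Submission
  imports Defs
begin

text \<open>
  In dimension 1|2 an odd codifferential \<open>d\<close> amounts to four data: the two-dimensional associative algebra
  \<open>B = V 1\<close> (\<open>d\<close> itself is associative on it), the left and right actions of \<open>B\<close> on the line \<open>V 0\<close>,
  which are a character of \<open>B\<close> and the negative of one, and the square \<open>u \<in> B\<close> of a generator \<open>\<theta>\<close> of \<open>V 0\<close>.
  Either \<open>B\<close> contains a nonzero idempotent \<open>e\<close>, and the Peirce decomposition gives
  \<open>B = \<complex>e \<oplus> \<complex>n\<close> with \<open>n\<close> an eigenvector of both multiplications by \<open>e\<close>, or \<open>B\<close> is nilpotent; this leaves
  seven algebras. If \<open>u \<noteq> 0\<close>, both characters coincide and \<open>u\<close> spans an ideal on which \<open>B\<close> acts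
  through that character, so \<open>u\<close> is unique up to automorphisms of \<open>B\<close> and a scalar, which rescaling \<open>\<theta>\<close> absorbs as \<open>\<complex>\<close> has
  square roots. The 28 resulting forms are separated by the vanishing of a few products, and a graded associative
  product differs from its codifferential only by a sign on the first argument.
\<close>

section \<open>Two-dimensional associative algebras\<close>

locale complex_vector_space = vector_space scale
  for scale :: "complex \<Rightarrow> 'v::ab_group_add \<Rightarrow> 'v" (infixr "*s" 75)
begin

section \<open>Ordered bases of a plane\<close>

definition pair_basis :: "'v set \<Rightarrow> 'v \<Rightarrow> 'v \<Rightarrow> bool" where
  "pair_basis S x y \<longleftrightarrow> x \<in> S \<and> y \<in> S \<and>
     (\<forall>a b. a *s x + b *s y = 0 \<longrightarrow> a = 0 \<and> b = 0) \<and> (\<forall>z\<in>S. \<exists>a b. z = a *s x + b *s y)"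

lemma pair_basis_coeff_eq:
  assumes "pair_basis S x y"
  shows "a *s x + b *s y = c *s x + d *s y \<longleftrightarrow> a = c \<and> b = d"
proof
  assume "a *s x + b *s y = c *s x + d *s y"
  then have "(a - c) *s x + (b - d) *s y = 0"
    by (simp add: scale_left_diff_distrib diff_add_eq add_diff_eq)
  then show "a = c \<and> b = d"
    using assms unfolding pair_basis_def by (metis eq_iff_diff_eq_0)
qed auto

lemma pair_basis_swap: "pair_basis S x y \<Longrightarrow> pair_basis S y x"
  unfolding pair_basis_def by (metis add.commute)

lemma combine_scaled:
  "k *s (a *s x + b *s y) + l *s (c *s x + d *s y) = (k * a + l * c) *s x + (k * b + l * d) *s y"
  by (simp add: scale_right_distrib scale_left_distrib ac_simps)

lemma pair_basis_transform:
  assumes S: "subspace S" and xy: "pair_basis S x y" and D: "a * d - b * c \<noteq> 0"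
  shows "pair_basis S (a *s x + b *s y) (c *s x + d *s y)"
  unfolding pair_basis_def
proof (intro conjI allI impI ballI)
  have xS: "x \<in> S" "y \<in> S" using xy by (auto simp: pair_basis_def)
  show "a *s x + b *s y \<in> S" "c *s x + d *s y \<in> S"
    using S xS by (auto intro: subspace_add subspace_scale)
next
  fix k l assume "k *s (a *s x + b *s y) + l *s (c *s x + d *s y) = 0"
  then have "k * a + l * c = 0 \<and> k * b + l * d = 0"
    using xy unfolding combine_scaled pair_basis_def by blast
  then have "k * (a * d - b * c) = 0 \<and> l * (a * d - b * c) = 0"
    by algebra
  then show "k = 0" "l = 0" using D by auto
next
  fix z assume "z \<in> S"
  then obtain m n where z: "z = m *s x + n *s y" using xy unfolding pair_basis_def by blast
  \<comment> \<open>Cramer's rule for the coordinates of \<open>z\<close> in the new basis.\<close>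
  define k where "k = (m * d - n * c) / (a * d - b * c)"
  define l where "l = (n * a - m * b) / (a * d - b * c)"
  have "k * a + l * c = (m * (a * d - b * c)) / (a * d - b * c)"
    "k * b + l * d = (n * (a * d - b * c)) / (a * d - b * c)"
    by (simp_all add: k_def l_def algebra_simps add_divide_distrib diff_divide_distrib)
  then have "k * a + l * c = m" "k * b + l * d = n" using D by simp_all
  then have "z = k *s (a *s x + b *s y) + l *s (c *s x + d *s y)"
    using z unfolding combine_scaled by simp
  then show "\<exists>a' b'. z = a' *s (a *s x + b *s y) + b' *s (c *s x + d *s y)" by blast
qed

text \<open>If the determinant vanished, the two rows of the adjugate matrix would give linear
  relations between \<open>x'\<close> and \<open>y'\<close>. Independence then kills all four
  coordinates, so \<open>x' = 0\<close>, which is itself a relation.\<close>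

lemma pair_basis_exchange:
  assumes S: "subspace S" and xy: "pair_basis S x y" and "x' \<in> S" "y' \<in> S"
    and ind: "\<And>a b. a *s x' + b *s y' = 0 \<Longrightarrow> a = 0 \<and> b = 0"
  shows "pair_basis S x' y'"
proof -
  obtain a b c d where x': "x' = a *s x + b *s y" and y': "y' = c *s x + d *s y"
    using assms unfolding pair_basis_def by meson
  have "a * d - b * c \<noteq> 0"
  proof
    assume D: "a * d - b * c = 0"
    have 0: "d *s x' + (- b) *s y' = 0" "(- c) *s x' + a *s y' = 0"
      using D unfolding x' y' combine_scaled by (simp_all add: algebra_simps)
    have "a = 0" "b = 0" using ind[OF 0(1)] ind[OF 0(2)] by simp_all
    then have "1 *s x' + 0 *s y' = 0" by (simp add: x')
    from ind[OF this] show False by simp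
  qed
  then show ?thesis using pair_basis_transform[OF S xy] x' y' by simp
qed

lemma bilinear_op_simps:
  assumes "bilinear_op scale d"
  shows "d (x + y) z = d x z + d y z" "d x (y + z) = d x y + d x z"
    "d (c *s x) z = c *s d x z" "d x (c *s z) = c *s d x z" "d 0 z = 0" "d x 0 = 0"
    "d (x - y) z = d x z - d y z" "d x (y - z) = d x y - d x z" "d (- x) z = - d x z" "d x (- z) = - d x z"
proof -
  have l: "Vector_Spaces.linear scale scale (d x)" "Vector_Spaces.linear scale scale (\<lambda>x. d x z)" for x z
    using assms unfolding bilinear_op_def by auto
  note l = this[THEN Vector_Spaces.linear.axioms(3)]
  show "d (x + y) z = d x z + d y z" "d x (y + z) = d x y + d x z"
    "d (c *s x) z = c *s d x z" "d x (c *s z) = c *s d x z" "d 0 z = 0" "d x 0 = 0"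
    "d (x - y) z = d x z - d y z" "d x (y - z) = d x y - d x z" "d (- x) z = - d x z" "d x (- z) = - d x z"
    using module_hom.add[OF l(2)] module_hom.add[OF l(1)] module_hom.scale[OF l(2)]
      module_hom.scale[OF l(1)] module_hom.zero[OF l(2)] module_hom.zero[OF l(1)]
      module_hom.diff[OF l(2)] module_hom.diff[OF l(1)] module_hom.neg[OF l(2)] module_hom.neg[OF l(1)] by auto
qed

end

locale plane_algebra = complex_vector_space scale
  for scale :: "complex \<Rightarrow> 'v::ab_group_add \<Rightarrow> 'v" (infixr "*s" 75) +
  fixes S :: "'v set" and f :: "'v \<Rightarrow> 'v \<Rightarrow> 'v"
  assumes subspace: "subspace S"
    and bilinear: "bilinear_op scale f"
    and closed: "x \<in> S \<Longrightarrow> y \<in> S \<Longrightarrow> f x y \<in> S"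
    and assoc: "x \<in> S \<Longrightarrow> y \<in> S \<Longrightarrow> z \<in> S \<Longrightarrow> f (f x y) z = f x (f y z)"
begin

lemmas bilin = bilinear_op_simps[OF bilinear]

text \<open>The list \<open>cs\<close> holds the coordinates of \<open>nn, ne, en, ee\<close> with respect to \<open>n, e\<close>.\<close>

definition table :: "'v \<Rightarrow> 'v \<Rightarrow> complex list \<Rightarrow> bool" where
  "table n e cs \<longleftrightarrow> pair_basis S n e \<and>
     [f n n, f n e, f e n, f e e] =
     [cs!0 *s n + cs!1 *s e, cs!2 *s n + cs!3 *s e, cs!4 *s n + cs!5 *s e, cs!6 *s n + cs!7 *s e]"

lemma basis_mult_plane:
  assumes "pair_basis S x y"
    and "f x x = p *s x + p' *s y" "f x y = q *s x + q' *s y"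
      "f y x = r *s x + r' *s y" "f y y = t *s x + t' *s y"
  shows "f (a *s x + b *s y) (c *s x + d *s y) =
    (a*c*p + a*d*q + b*c*r + b*d*t) *s x + (a*c*p' + a*d*q' + b*c*r' + b*d*t') *s y"
  by (simp add: bilin assms scale_right_distrib scale_left_distrib ac_simps)

text \<open>If some \<open>x\<close> and its square form a basis, the algebra is generated by
  \<open>x\<close>, and the coefficients of x^3 = \<alpha> x + \<beta> x^2 decide: an idempotent is
  a polynomial in \<open>x\<close> unless both vanish. Otherwise every square is a multiple of its
  root; a nonzero one rescales to an idempotent, and if all vanish the product is zero.\<close>

lemma idempotent_or_nilpotent:
  assumes xy: "pair_basis S x0 y0"
  shows "(\<exists>e\<in>S. e \<noteq> 0 \<and> f e e = e) \<or> (\<exists>n e. table n e [0,0,0,0,0,0,1,0]) \<or>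
    (\<exists>n e. table n e [0,0,0,0,0,0,0,0])"
proof (cases "\<exists>x\<in>S. pair_basis S x (f x x)")
  case True
  then obtain x y where x: "x \<in> S" and y: "y = f x x" and b: "pair_basis S x y" by blast
  have yS: "y \<in> S" using closed x y by simp
  then obtain \<alpha> \<beta> where fxy: "f x y = \<alpha> *s x + \<beta> *s y"
    using b closed x unfolding pair_basis_def by blast
  have fyx: "f y x = f x y" using assoc x y by simp
  have fyy: "f y y = f x (f x y)" using assoc x yS y by metis
  have fyy': "f y y = (\<beta> * \<alpha>) *s x + (\<alpha> + \<beta> * \<beta>) *s y"
    unfolding fyy fxy by (simp add: bilin fxy y[symmetric] scale_right_distrib scale_left_distrib ac_simps)
  note mult = basis_mult_plane[OF b _ fxy fyx[unfolded fxy] fyy', of 0 1]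
  have mult: "f (a *s x + b *s y) (c *s x + d *s y) =
    ((a * d + b * c) * \<alpha> + b * d * \<beta> * \<alpha>) *s x +
    (a * c + (a * d + b * c) * \<beta> + b * d * (\<alpha> + \<beta> * \<beta>)) *s y" for a b c d
    using mult[of a b c d] y by (simp add: algebra_simps)
  have nz: "a *s x + b *s y \<noteq> 0" if "b \<noteq> 0" for a b
    using that \<open>pair_basis S x y\<close> unfolding pair_basis_def by blast
  have inS: "a *s x + b *s y \<in> S" for a b
    using x yS subspace by (auto intro: subspace_add subspace_scale)
  have *: ?thesis if "f (a *s x + b *s y) (a *s x + b *s y) = a *s x + b *s y" "b \<noteq> 0" for a b
    using that nz inS by metis
  consider "\<alpha> = 0" "\<beta> = 0" | "\<alpha> = 0" "\<beta> \<noteq> 0" | "\<alpha> \<noteq> 0" by blast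
  then show ?thesis
  proof cases
    case 1
    then have "table y x [0,0,0,0,0,0,1,0]"
      using b fyx fxy fyy' y by (simp add: table_def pair_basis_swap)
    then show ?thesis by blast
  next
    case 2
    \<comment> \<open>Here x^3 = \<beta> x^2, hence x^4 = \<beta>^2 x^2, so x^2 / \<beta>^2 is
      idempotent.\<close>
    then show ?thesis by (intro *[of 0 "1 / (\<beta> * \<beta>)"], subst mult) simp_all
  next
    case 3
    \<comment> \<open>From x (x^2 - \<beta> x) = \<alpha> x the element (x^2 - \<beta> x) / \<alpha>
      is a unit of the algebra generated by \<open>x\<close>, hence idempotent.\<close>
    show ?thesis
    proof (rule *[of "- \<beta> / \<alpha>" "1 / \<alpha>"])
      show "1 / \<alpha> \<noteq> 0" using 3 by simp
      have "(- \<beta> / \<alpha> * (1 / \<alpha>) + 1 / \<alpha> * (- \<beta> / \<alpha>)) * \<alpha> + 1 / \<alpha> * (1 / \<alpha>) * \<beta> * \<alpha> = - \<beta> / \<alpha>"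
        "- \<beta> / \<alpha> * (- \<beta> / \<alpha>) + (- \<beta> / \<alpha> * (1 / \<alpha>) + 1 / \<alpha> * (- \<beta> / \<alpha>)) * \<beta> + 1 / \<alpha> * (1 / \<alpha>) * (\<alpha> + \<beta> * \<beta>) = 1 / \<alpha>"
        using 3 by (simp_all add: divide_simps) (simp_all add: algebra_simps)?
      then show "f ((- \<beta> / \<alpha>) *s x + (1 / \<alpha>) *s y) ((- \<beta> / \<alpha>) *s x + (1 / \<alpha>) *s y) = (- \<beta> / \<alpha>) *s x + (1 / \<alpha>) *s y"
        unfolding mult by simp
    qed
  qed
next
  case False
  have sq: "\<exists>k. f x x = k *s x" if x: "x \<in> S" for x
  proof (cases "x = 0")
    case True then show ?thesis by (simp add: bilin)
  next
    case x0: False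
    obtain a b where ab: "a *s x + b *s f x x = 0" "a \<noteq> 0 \<or> b \<noteq> 0"
      \<comment> \<open>Since \<open>x\<close> and its square never form a basis, exchange yields a
        nontrivial relation between them.\<close>
      using pair_basis_exchange[OF subspace xy x closed[OF x x]] False x by blast
    then have "b \<noteq> 0" using x0 by auto
    have "f x x = (1 / b) *s (b *s f x x)" using \<open>b \<noteq> 0\<close> by simp
    also have "b *s f x x = (- a) *s x" using ab(1) by (simp add: eq_neg_iff_add_eq_0 add.commute)
    finally show ?thesis by (auto simp del: scale_minus_left)
  qed
  show ?thesis
  proof (cases "\<forall>x\<in>S. f x x = 0")
    case True
    have xS: "x0 \<in> S" "y0 \<in> S" using xy by (auto simp: pair_basis_def)
    then obtain a b where ab: "f x0 y0 = a *s x0 + b *s y0"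
      using closed[OF xS] xy unfolding pair_basis_def by blast
    have "f (x0 + y0) (x0 + y0) = 0" using True xS subspace by (simp add: subspace_add)
    then have anti: "f x0 y0 + f y0 x0 = 0" using True xS by (simp add: bilin add.commute)
    \<comment> \<open>Multiplying \<open>x0 y0\<close> by \<open>x0\<close> on the left and by
      \<open>y0\<close> on the right gives zero, as both squares vanish; in coordinates this is
      \<open>b\<close> and \<open>a\<close> times the product, so the product is zero.\<close>
    have "b *s f x0 y0 = f x0 (f x0 y0)" unfolding ab using True xS by (simp add: bilin ab)
    also have "\<dots> = 0" using assoc[of x0 x0 y0] True xS by (simp add: bilin)
    finally have "b *s f x0 y0 = 0" .
    moreover have "a *s f x0 y0 = f (f x0 y0) y0" unfolding ab using True xS by (simp add: bilin ab)
    moreover have "\<dots> = 0" using assoc[of x0 y0 y0] True xS by (simp add: bilin)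
    ultimately have "f x0 y0 = 0 \<or> a = 0 \<and> b = 0" by (metis scale_eq_0_iff)
    then have "f x0 y0 = 0" by (elim disjE) (simp_all add: ab)
    then have "table x0 y0 [0,0,0,0,0,0,0,0]"
      using anti True xS xy by (simp add: table_def)
    then show ?thesis by blast
  next
    case False
    then obtain x k where x: "x \<in> S" "f x x = k *s x" "k *s x \<noteq> 0" using sq by metis
    then have "(1 / k) *s x \<in> S \<and> (1 / k) *s x \<noteq> 0 \<and> f ((1 / k) *s x) ((1 / k) *s x) = (1 / k) *s x"
      using subspace by (auto simp: bilin subspace_scale)
    then show ?thesis by blast
  qed
qed

text \<open>Left and right multiplication by \<open>e\<close> are commuting projections that fix
  \<open>e\<close>. They are therefore simultaneously diagonalizable with eigenvalues 0 and 1, and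
  \<open>n\<close> is a second common eigenvector.\<close>

lemma peirce:
  assumes xy: "pair_basis S x0 y0" and e: "e \<in> S" "e \<noteq> 0" "f e e = e"
  obtains n i j where "pair_basis S n e" "f e n = i *s n" "f n e = j *s n"
    "i = 0 \<or> i = 1" "j = 0 \<or> j = 1"
proof -
  obtain p q where pq: "e = p *s x0 + q *s y0" using e xy unfolding pair_basis_def by blast
  \<comment> \<open>One of \<open>x0\<close>, \<open>y0\<close> is independent of \<open>e\<close>;
    which one is read off from the coordinates of \<open>e\<close>.\<close>
  obtain y where y: "pair_basis S y e"
  proof (cases "p = 0")
    case True
    then have "q \<noteq> 0" using pq e by auto
    then have "pair_basis S (1 *s x0 + 0 *s y0) (p *s x0 + q *s y0)"
      by (intro pair_basis_transform[OF subspace xy]) auto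
    then show ?thesis using that pq by simp
  next
    case False
    then have "pair_basis S (0 *s x0 + 1 *s y0) (p *s x0 + q *s y0)"
      by (intro pair_basis_transform[OF subspace xy]) auto
    then show ?thesis using that pq by simp
  qed
  have yS: "y \<in> S" using y by (simp add: pair_basis_def)
  obtain a b where ab: "f e y = a *s y + b *s e"
    using closed[OF e(1) yS] y unfolding pair_basis_def by blast
  obtain a' b' where ab': "f y e = a' *s y + b' *s e"
    using closed[OF yS e(1)] y unfolding pair_basis_def by blast
  note eq = pair_basis_coeff_eq[OF y]
  have "f (f e e) y = f e (f e y)" using assoc e yS by blast
  then have "a *s y + b *s e = (a * a) *s y + (a * b + b) *s e"
    unfolding e(3) unfolding ab by (simp add: bilin e ab scale_right_distrib scale_left_distrib ac_simps)
  then have 1: "a * a = a" "a * b = 0" unfolding eq by auto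
  have "f (f y e) e = f y (f e e)" using assoc e yS by blast
  then have "a' *s y + b' *s e = (a' * a') *s y + (a' * b' + b') *s e"
    unfolding e(3) unfolding ab' by (simp add: bilin e ab' scale_right_distrib scale_left_distrib ac_simps)
  then have 2: "a' * a' = a'" "a' * b' = 0" unfolding eq by auto
  have "f (f e y) e = f e (f y e)" using assoc e yS by blast
  then have "(a * a') *s y + (a * b' + b) *s e = (a' * a) *s y + (a' * b + b') *s e"
    unfolding ab ab' by (simp add: bilin e ab ab' scale_right_distrib scale_left_distrib ac_simps)
  then have 3: "a * b' + b = a' * b + b'" unfolding eq by auto
  \<comment> \<open>The vector \<open>y + c *s e\<close> is a left eigenvector iff
    \<open>b + c = a * c\<close>, and likewise on the right. If \<open>a = 0\<close>, this forces
    \<open>c = - b\<close>, and \<open>3\<close> makes the right condition follow. If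
    \<open>a = 1\<close>, then \<open>b = 0\<close>, the left condition is void, and
    \<open>- b'\<close> solves the right one.\<close>
  define c where "c = (if a = 0 then - b else - b')"
  have i: "a = 0 \<or> a = 1" "a' = 0 \<or> a' = 1" using 1 2 by auto
  have c: "b + c = a * c" "b' + c = a' * c"
  proof -
    have "b + - b = 0 * - b" "a = 0 \<Longrightarrow> b' + - b = a' * - b" using 3 by (simp, algebra)
    then show "b + c = a * c" "b' + c = a' * c"
      using i(1) 1(2) 2(2) by (auto simp: c_def)
  qed
  have "pair_basis S (1 *s y + c *s e) (0 *s y + 1 *s e)"
    by (intro pair_basis_transform[OF subspace y]) auto
  then have n: "pair_basis S (y + c *s e) e" by simp
  have "f e (y + c *s e) = a *s y + (b + c) *s e"
    by (simp add: bilin ab e scale_left_distrib ac_simps)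
  then have fen: "f e (y + c *s e) = a *s (y + c *s e)"
    by (simp add: c scale_right_distrib)
  have "f (y + c *s e) e = a' *s y + (b' + c) *s e"
    by (simp add: bilin ab' e scale_left_distrib ac_simps)
  then have fne: "f (y + c *s e) e = a' *s (y + c *s e)"
    by (simp add: c scale_right_distrib)
  show ?thesis using that[OF n fen fne i] .
qed

text \<open>In the unital case completing the square makes \<open>n\<^sup>2\<close> a multiple of the unit \<open>e\<close>.\<close>

lemma unital_plane:
  assumes ne: "pair_basis S n e" and t: "f e n = n" "f n e = n" "f e e = e"
  shows "\<exists>n e. table n e [1,0,0,0,0,0,0,1] \<or> table n e [0,0,1,0,1,0,0,1]"
proof -
  have nS: "n \<in> S" "e \<in> S" using ne by (auto simp: pair_basis_def)
  obtain \<alpha> \<beta> where nn: "f n n = \<alpha> *s n + \<beta> *s e"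
    using closed[OF nS(1) nS(1)] ne unfolding pair_basis_def by blast
  define m where "m = 1 *s n + (- \<alpha> / 2) *s e"
  define \<gamma> where "\<gamma> = \<beta> + \<alpha>\<^sup>2 / 4"
  have "pair_basis S m (0 *s n + 1 *s e)"
    unfolding m_def by (intro pair_basis_transform[OF subspace ne]) auto
  then have m: "pair_basis S m e" by simp
  have em: "f e m = m" "f m e = m" by (simp_all add: m_def bilin t del: scale_minus_left)
  have "f m m = (1 * 1 * \<alpha> + 1 * (- \<alpha> / 2) * 1 + (- \<alpha> / 2) * 1 * 1 + (- \<alpha> / 2) * (- \<alpha> / 2) * 0) *s n
     + (1 * 1 * \<beta> + 1 * (- \<alpha> / 2) * 0 + (- \<alpha> / 2) * 1 * 0 + (- \<alpha> / 2) * (- \<alpha> / 2) * 1) *s e"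
    unfolding m_def by (rule basis_mult_plane[OF ne nn]) (simp_all add: t)
  also have "\<dots> = \<gamma> *s e" by (simp add: \<gamma>_def power2_eq_square)
  finally have mm: "f m m = \<gamma> *s e" .
  show ?thesis
  proof (cases "\<gamma> = 0")
    case True
    then have "table m e [0,0,1,0,1,0,0,1]" using m em mm t by (simp add: table_def)
    then show ?thesis by blast
  next
    case False
    \<comment> \<open>With this \<open>r\<close> the square of \<open>r *s m\<close> is e/4, so e/2
      + r m and e/2 - r m are orthogonal idempotents.\<close>
    define r where "r = 1 / (2 * csqrt \<gamma>)"
    have r: "4 * (r * r * \<gamma>) = 1"
      using False power2_csqrt[of \<gamma>] by (simp add: r_def power2_eq_square)
    then have "r \<noteq> 0" by auto
    define e1 e2 where e1: "e1 = r *s m + (1/2) *s e" and e2: "e2 = (- r) *s m + (1/2) *s e"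
    have pb: "pair_basis S e1 e2"
      unfolding e1 e2 by (intro pair_basis_transform[OF subspace m]) (use \<open>r \<noteq> 0\<close> in auto)
    have mult: "f (a *s m + b *s e) (c *s m + d *s e) = (a * d + b * c) *s m + (a * c * \<gamma> + b * d) *s e" for a b c d
      using basis_mult_plane[OF m, of 0 \<gamma> 1 0 1 0 0 1 a b c d] em mm t by simp
    have r': "r * r * \<gamma> = 1 / 4" using r by (simp add: field_simps)
    have "table e1 e2 [1,0,0,0,0,0,0,1]"
      using pb unfolding table_def e1 e2 mult by (simp add: r' del: scale_minus_left)
    then show ?thesis by blast
  qed
qed

text \<open>The tables stand, in order, for the product of two copies of the field, the dual
  numbers, the field plus a null line, \<open>e\<close> a left unit with \<open>n e = 0\<close>,
  \<open>e\<close> a right unit with \<open>e n = 0\<close>, the nilpotent algebra with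
  \<open>e e = n\<close>, and the null algebra. The Peirce eigenvalues of \<open>n\<close> select
  the case.\<close>

theorem plane_classification:
  assumes xy: "pair_basis S x0 y0"
  shows "\<exists>n e. table n e [1,0,0,0,0,0,0,1] \<or> table n e [0,0,1,0,1,0,0,1] \<or>
    table n e [0,0,0,0,0,0,0,1] \<or> table n e [0,0,0,0,1,0,0,1] \<or> table n e [0,0,1,0,0,0,0,1] \<or>
    table n e [0,0,0,0,0,0,1,0] \<or> table n e [0,0,0,0,0,0,0,0]"
proof (cases "\<exists>e\<in>S. e \<noteq> 0 \<and> f e e = e")
  case False
  then show ?thesis using idempotent_or_nilpotent[OF xy] by blast
next
  case True
  then obtain e where e: "e \<in> S" "e \<noteq> 0" "f e e = e" by blast
  then obtain n i j where n: "pair_basis S n e" "f e n = i *s n" "f n e = j *s n"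
    and i: "i = 0 \<or> i = 1" and j: "j = 0 \<or> j = 1" using peirce[OF xy] by metis
  then have nS: "n \<in> S" by (simp add: pair_basis_def)
  \<comment> \<open>This reads \<open>i n n = j n n\<close>, so \<open>n n = 0\<close> whenever the
    eigenvalues differ.\<close>
  have "f n (f e n) = f (f n e) n" using assoc e nS by simp
  then have nn: "i *s f n n = j *s f n n" unfolding n by (simp add: bilin)
  consider "i = 1" "j = 1" | "i = 1" "j = 0" | "i = 0" "j = 1" | "i = 0" "j = 0" using i j by blast
  then show ?thesis
  proof cases
    case 1
    then show ?thesis using unital_plane[OF n(1)] n e by fastforce
  next
    case 2
    then have "table n e [0,0,0,0,1,0,0,1]" using n nn e by (simp add: table_def)
    then show ?thesis by blast
  next
    case 3
    then have "table n e [0,0,1,0,0,0,0,1]" using n nn e by (simp add: table_def)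
    then show ?thesis by blast
  next
    case 4
    obtain \<alpha> \<beta> where nn: "f n n = \<alpha> *s n + \<beta> *s e"
      using closed[OF nS nS] n unfolding pair_basis_def by blast
    \<comment> \<open>As \<open>e\<close> annihilates \<open>n\<close>, it annihilates
      \<open>n n\<close>, which therefore has no component along \<open>e\<close>.\<close>
    have "f e (f n n) = f (f e n) n" using assoc e nS by simp
    then have "\<beta> *s e = 0" unfolding nn n 4 by (simp add: bilin e n 4)
    then have nn: "f n n = \<alpha> *s n" using e nn by simp
    show ?thesis
    proof (cases "\<alpha> = 0")
      case True
      then have "table n e [0,0,0,0,0,0,0,1]" using n 4 nn e by (simp add: table_def)
      then show ?thesis by blast
    next
      case False
      have "pair_basis S ((1/\<alpha>) *s n + 0 *s e) (0 *s n + 1 *s e)"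
        by (intro pair_basis_transform[OF subspace n(1)]) (use False in auto)
      then have "table ((1/\<alpha>) *s n) e [1,0,0,0,0,0,0,1]"
        using n 4 nn e False by (simp add: table_def bilin)
      then show ?thesis by blast
    qed
  qed
qed

end

section \<open>Structure constants on a space of dimension 1|2\<close>

locale graded_1_2 = complex_vector_space scale
  for scale :: "complex \<Rightarrow> 'v::ab_group_add \<Rightarrow> 'v" (infixr "*s" 75) +
  fixes V :: "bit \<Rightarrow> 'v set" and v :: "nat \<Rightarrow> 'v"
  assumes graded: "graded_space scale V" and basis: "homogeneous_basis_1_2 scale V v"
begin

definition vec :: "complex \<Rightarrow> complex \<Rightarrow> complex \<Rightarrow> 'v" where
  "vec a b c = a *s v 1 + b *s v 2 + c *s v 3"

abbreviation crd :: "nat \<Rightarrow> 'v \<Rightarrow> complex" where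
  "crd i x \<equiv> representation (v ` {1, 2, 3}) x (v i)"

lemma v_distinct: "v 1 \<noteq> v 2" "v 1 \<noteq> v 3" "v 2 \<noteq> v 3"
  using basis unfolding homogeneous_basis_1_2_def inj_on_def by fastforce+

lemma independent_v: "independent (v ` {1, 2, 3})" and span_v: "span (v ` {1, 2, 3}) = UNIV"
  using basis unfolding homogeneous_basis_1_2_def is_basis_def by auto

lemma vec_crd: "vec (crd 1 x) (crd 2 x) (crd 3 x) = x"
proof -
  have "(\<Sum>b\<in>v ` {1,2,3}. representation (v ` {1,2,3}) x b *s b) = x"
    by (rule sum_representation_eq) (simp_all add: independent_v[simplified] span_v[simplified])
  then show ?thesis using v_distinct v_distinct[symmetric] by (simp add: vec_def add.assoc)
qed

lemma crd_vec: "crd 1 (vec a b c) = a" "crd 2 (vec a b c) = b" "crd 3 (vec a b c) = c"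
proof -
  have r: "crd i (vec a b c) = a * crd i (v 1) + b * crd i (v 2) + c * crd i (v 3)" for i
    unfolding vec_def
    by (simp only: representation_add[OF independent_v] representation_scale[OF independent_v] span_v UNIV_I)
  have b: "representation (v ` {1,2,3}) (v j) = (\<lambda>x. if x = v j then 1 else 0)" if "j \<in> {1,2,3}" for j
    using that by (intro representation_basis[OF independent_v]) auto
  show "crd 1 (vec a b c) = a" "crd 2 (vec a b c) = b" "crd 3 (vec a b c) = c"
    unfolding r using b[of 1] b[of 2] b[of 3] v_distinct v_distinct[symmetric] by simp_all
qed

lemma vec_cases: obtains a b c where "x = vec a b c"
  using vec_crd by metis

lemma vec_eq_iff: "vec a b c = vec a' b' c' \<longleftrightarrow> a = a' \<and> b = b' \<and> c = c'"
  using crd_vec by metis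

lemma vec_arith:
  "vec a b c + vec a' b' c' = vec (a + a') (b + b') (c + c')"
  "vec a b c - vec a' b' c' = vec (a - a') (b - b') (c - c')"
  "k *s vec a b c = vec (k * a) (k * b) (k * c)"
  "- vec a b c = vec (- a) (- b) (- c)"
  by (simp_all add: vec_def scale_left_distrib scale_right_distrib scale_left_diff_distrib algebra_simps)

lemma vec_0: "vec a b c = 0 \<longleftrightarrow> a = 0 \<and> b = 0 \<and> c = 0" "0 = vec 0 0 0"
  using vec_eq_iff[of a b c 0 0 0] by (simp_all add: vec_def)

lemma v_vec: "v 1 = vec 1 0 0" "v 2 = vec 0 1 0" "v (Suc 0) = vec 1 0 0" "v 3 = vec 0 0 1"
  by (simp_all add: vec_def)

lemma subspace_V: "subspace (V p)"
  using graded unfolding graded_space_def by blast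

lemma V_disjoint: "x \<in> V 0 \<Longrightarrow> x \<in> V 1 \<Longrightarrow> x = 0"
  using graded unfolding graded_space_def by blast

text \<open>The basis vectors only give one inclusion for each part. The other comes from directness
  of the sum: subtracting the component of the right parity leaves a vector of both
  parities.\<close>

lemma mem_V: "vec a b c \<in> V 0 \<longleftrightarrow> b = 0 \<and> c = 0" "vec a b c \<in> V 1 \<longleftrightarrow> a = 0"
proof -
  have v: "v 1 \<in> V 0" "v 2 \<in> V 1" "v 3 \<in> V 1"
    using basis unfolding homogeneous_basis_1_2_def by auto
  have 0: "vec a 0 0 \<in> V 0" for a using v by (simp add: vec_def subspace_scale subspace_V)
  have 1: "vec 0 b c \<in> V 1" for b c using v by (simp add: vec_def subspace_scale subspace_add subspace_V)
  show "vec a b c \<in> V 0 \<longleftrightarrow> b = 0 \<and> c = 0"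
  proof
    assume "vec a b c \<in> V 0"
    then have "vec a b c - vec a 0 0 \<in> V 0" using 0 subspace_V subspace_diff by blast
    then have "vec 0 b c \<in> V 0" by (simp add: vec_arith)
    then show "b = 0 \<and> c = 0" using V_disjoint[OF _ 1] vec_0 by blast
  qed (use 0 in auto)
  show "vec a b c \<in> V 1 \<longleftrightarrow> a = 0"
  proof
    assume "vec a b c \<in> V 1"
    then have "vec a b c - vec 0 b c \<in> V 1" using 1 subspace_V subspace_diff by blast
    then have "vec a 0 0 \<in> V 1" by (simp add: vec_arith)
    then show "a = 0" using V_disjoint[OF 0] vec_0 by blast
  qed (use 1 in auto)
qed

lemma V_cases:
  "x \<in> V 0 \<longleftrightarrow> (\<exists>a. x = vec a 0 0)" "x \<in> V 1 \<longleftrightarrow> (\<exists>b c. x = vec 0 b c)"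
  by (rule vec_cases[of x], auto simp: mem_V vec_eq_iff)+

text \<open>The structure constants of an odd product are listed in the order
  \<open>11\<rightarrow>2, 11\<rightarrow>3, 12\<rightarrow>1, 13\<rightarrow>1, 21\<rightarrow>1, 31\<rightarrow>1, 22\<rightarrow>2, 22\<rightarrow>3, 23\<rightarrow>2, 23\<rightarrow>3, 32\<rightarrow>2, 32\<rightarrow>3, 33\<rightarrow>2, 33\<rightarrow>3\<close>.\<close>

definition tab :: "complex list \<Rightarrow> 'v \<Rightarrow> 'v \<Rightarrow> 'v" where
  "tab L x y = vec
     (L!2 * (crd 1 x * crd 2 y) + L!3 * (crd 1 x * crd 3 y) + L!4 * (crd 2 x * crd 1 y) + L!5 * (crd 3 x * crd 1 y))
     (L!0 * (crd 1 x * crd 1 y) + L!6 * (crd 2 x * crd 2 y) + L!8 * (crd 2 x * crd 3 y) +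
      L!10 * (crd 3 x * crd 2 y) + L!12 * (crd 3 x * crd 3 y))
     (L!1 * (crd 1 x * crd 1 y) + L!7 * (crd 2 x * crd 2 y) + L!9 * (crd 2 x * crd 3 y) +
      L!11 * (crd 3 x * crd 2 y) + L!13 * (crd 3 x * crd 3 y))"

lemma tab_vec:
  "tab L (vec a b c) (vec a' b' c') = vec
     (L!2 * (a * b') + L!3 * (a * c') + L!4 * (b * a') + L!5 * (c * a'))
     (L!0 * (a * a') + L!6 * (b * b') + L!8 * (b * c') + L!10 * (c * b') + L!12 * (c * c'))
     (L!1 * (a * a') + L!7 * (b * b') + L!9 * (b * c') + L!11 * (c * b') + L!13 * (c * c'))"
  unfolding tab_def crd_vec ..

text \<open>The coefficients of d_1 to d_28 in this order. As lists of numerals, membership and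
  distinctness become matters of simplification.\<close>

definition normal_forms :: "complex list list" where
  "normal_forms = [
      [0, 1, 0, 1, 0, -1, 1, 0, 0, 0, 0, 0, 0, -1],
      [0, 1, 0, 1, 0, -1, 0, 0, 0, 0, 0, 0, 0, -1],
      [0, 0, -1, 0, 0, 0, 1, 0, 0, 0, 0, 0, 0, 1],
      [0, 0, 0, 0, 1, 0, 1, 0, 0, 0, 0, 0, 0, 1],
      [0, 0, 0, -1, 1, 0, 1, 0, 0, 0, 0, 0, 0, 1],
      [0, 0, -1, 0, 1, 0, 1, 0, 0, 0, 0, 0, 0, 1],
      [0, 0, 0, 0, 0, 0, 1, 0, 0, 0, 0, 0, 0, 1],
      [1, 0, 0, -1, 0, 1, 0, 0, 1, 0, 1, 0, 0, 1],
      [1, 0, 0, 0, 0, 0, 0, 0, 0, 0, 0, 0, 0, 1],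
      [0, 0, 0, -1, 0, 0, 0, 0, 1, 0, 0, 0, 0, 1],
      [0, 0, 0, 0, 0, 1, 0, 0, 0, 0, 1, 0, 0, 1],
      [0, 0, 0, 0, 0, 1, 0, 0, 1, 0, 0, 0, 0, 1],
      [0, 0, 0, -1, 0, 0, 0, 0, 0, 0, 1, 0, 0, 1],
      [0, 0, 0, -1, 0, 1, 0, 0, 1, 0, 0, 0, 0, 1],
      [0, 0, 0, -1, 0, 1, 0, 0, 0, 0, 1, 0, 0, 1],
      [0, 0, 0, 0, 0, 0, 0, 0, 1, 0, 0, 0, 0, 1],
      [0, 0, 0, 0, 0, 0, 0, 0, 0, 0, 1, 0, 0, 1],
      [0, 0, 0, -1, 0, 0, 0, 0, 1, 0, 1, 0, 0, 1],
      [0, 0, 0, 0, 0, 1, 0, 0, 1, 0, 1, 0, 0, 1],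
      [0, 0, 0, 0, 0, 0, 0, 0, 1, 0, 1, 0, 0, 1],
      [0, 0, 0, -1, 0, 0, 0, 0, 0, 0, 0, 0, 0, 1],
      [0, 0, 0, 0, 0, 1, 0, 0, 0, 0, 0, 0, 0, 1],
      [0, 0, 0, -1, 0, 1, 0, 0, 0, 0, 0, 0, 0, 1],
      [0, 0, 0, -1, 0, 1, 0, 0, 1, 0, 1, 0, 0, 1],
      [0, 0, 0, 0, 0, 0, 0, 0, 0, 0, 0, 0, 0, 1],
      [1, 0, 0, 0, 0, 0, 0, 0, 0, 0, 0, 0, 1, 0],
      [1, 0, 0, 0, 0, 0, 0, 0, 0, 0, 0, 0, 0, 0],
      [0, 0, 0, 0, 0, 0, 0, 0, 0, 0, 0, 0, 1, 0]]"

lemma linear_intro: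
  assumes "\<And>x y. g (x + y) = g x + g y" "\<And>k x. g (k *s x) = k *s g x"
  shows "Vector_Spaces.linear scale scale g"
  by (intro Vector_Spaces.linear.intro module_hom.intro module_hom_axioms.intro)
    (simp_all add: assms vector_space_axioms module_axioms)

lemma bilinear_tab: "bilinear_op scale (tab L)"
  unfolding bilinear_op_def
proof (intro conjI allI linear_intro)
  fix x y z k
  obtain a b c a' b' c' a'' b'' c'' where "x = vec a b c" "y = vec a' b' c'" "z = vec a'' b'' c''"
    using vec_cases by metis
  then show "tab L x (y + z) = tab L x y + tab L x z" "tab L x (k *s y) = k *s tab L x y"
     "tab L (y + z) x = tab L y x + tab L z x" "tab L (k *s y) x = k *s tab L y x"
    by (simp_all add: vec_arith tab_vec vec_eq_iff algebra_simps)
qed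

lemma odd_tab: "op_of_parity V 1 (tab L)"
  unfolding op_of_parity_def
proof (intro allI ballI)
  fix p q x y assume "x \<in> V p" "y \<in> V q"
  then show "tab L x y \<in> V (p + q + 1)"
    by (cases p; cases q) (auto simp: V_cases(1)[of x] V_cases(2)[of x] V_cases(1)[of y] V_cases(2)[of y] tab_vec mem_V)
qed

lemma codiff_eq_tab: "map (codiff scale v) [1..<29] = map tab normal_forms"
proof -
  have psi: "psi scale v i j k (vec a b c) (vec a' b' c') =
    (crd i (vec a b c) * crd j (vec a' b' c')) *s v k" for i j k a b c a' b' c'
    unfolding psi_def Let_def ..
  have *: "d = tab L" if "\<And>a b c a' b' c'. d (vec a b c) (vec a' b' c') = tab L (vec a b c) (vec a' b' c')" for d L
    by (intro ext) (metis that vec_crd)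
  have l: "map (codiff scale v) [1..<29] = codiff_list scale v"
    by (rule nth_equalityI) (auto simp: codiff_def codiff_list_def Let_def)
  show ?thesis
    unfolding l codiff_list_def Let_def normal_forms_def list.map
    by (intro arg_cong2[of _ _ _ _ Cons] refl *)
       (simp only: plus_fun_apply fun_diff_def psi crd_vec, simp only: v_vec vec_arith, simp add: tab_vec vec_eq_iff)+
qed

lemma all_V: "(\<forall>x\<in>V 0. P x) \<longleftrightarrow> (\<forall>a. P (vec a 0 0))" "(\<forall>x\<in>V 1. P x) \<longleftrightarrow> (\<forall>b c. P (vec 0 b c))"
  and ex_V: "(\<exists>x\<in>V 0. P x) \<longleftrightarrow> (\<exists>a. P (vec a 0 0))" "(\<exists>x\<in>V 1. P x) \<longleftrightarrow> (\<exists>b c. P (vec 0 b c))"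
  by (metis V_cases)+

lemma all_bit: "(\<forall>p::bit. P p) \<longleftrightarrow> P 0 \<and> P 1"
  by (metis bit.exhaust)

lemma odd_codifferential_normal_forms:
  assumes "L \<in> set normal_forms"
  shows "odd_codifferential scale V (tab L)"
  unfolding odd_codifferential_def
  using assms bilinear_tab odd_tab
  unfolding normal_forms_def list.set insert_iff empty_iff all_bit all_V parity_sign_def
  by (elim disjE) (simp_all add: tab_vec vec_arith vec_0(1) algebra_simps)

section \<open>Invariants\<close>

text \<open>The definition demands only inclusion. A preimage of a homogeneous vector splits into
  its components; the one of the wrong parity is sent to a vector of both parities, hence to 0, and
  vanishes by injectivity.\<close>

lemma even_automorphism_image:
  assumes "even_automorphism scale V g"
  shows "g ` V p = V p"
proof
  have bij: "bij g" and sub: "g ` V p \<subseteq> V p" for p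
    using assms unfolding even_automorphism_def by auto
  have "Vector_Spaces.linear scale scale g" using assms unfolding even_automorphism_def by blast
  note hom = Vector_Spaces.linear.axioms(3)[OF this]
  have inj: "g z = 0 \<Longrightarrow> z = 0" for z
    using module_hom.zero[OF hom] bij by (metis bij_pointE)
  show "g ` V p \<subseteq> V p" by (rule sub)
  show "V p \<subseteq> g ` V p"
  proof
    fix y assume y: "y \<in> V p"
    obtain x where x: "y = g x" using bij by (metis bij_pointE)
    obtain a b where ab: "a \<in> V 0" "b \<in> V 1" "x = a + b"
      using graded unfolding graded_space_def by blast
    have g: "g a \<in> V 0" "g b \<in> V 1" using sub ab by blast+
    have y_eq: "y = g a + g b" unfolding x ab(3) by (rule module_hom.add[OF hom])
    consider "p = 0" | "p = 1" by (cases p) auto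
    then show "y \<in> g ` V p"
    proof cases
      case 1
      have "y - g a \<in> V 0" using g y subspace_V subspace_diff 1 by blast
      then have "g b = 0" using V_disjoint g(2) by (simp add: y_eq)
      then show ?thesis using 1 ab x inj by (metis add.right_neutral imageI)
    next
      case 2
      have "y - g b \<in> V 1" using g y subspace_V subspace_diff 2 by blast
      then have "g a = 0" using V_disjoint g(1) by (simp add: y_eq)
      then show ?thesis using 2 ab x inj by (metis add.left_neutral imageI)
    qed
  qed
qed

text \<open>The first three and the last two entries tell the algebra on \<open>B\<close> apart, the
  last one separating the left-unit table from the right-unit table. The middle four record whether
  the square of \<open>\<theta>\<close>, the two actions and their sum vanish. Taking
  \<open>E\<close> and \<open>B\<close> as arguments lets invariance be shown by replacing them with
  their images under the automorphism.\<close>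

definition invariants :: "'v set \<Rightarrow> 'v set \<Rightarrow> ('v \<Rightarrow> 'v \<Rightarrow> 'v) \<Rightarrow> bool list" where
  "invariants E B d =
    [\<forall>x\<in>B. \<forall>y\<in>B. d x y = 0,
     \<forall>x\<in>B. \<forall>y\<in>B. d x y = d y x,
     \<forall>x\<in>B. \<forall>y\<in>B. \<forall>z\<in>B. d (d x y) z = 0,
     \<forall>t\<in>E. d t t = 0,
     \<forall>t\<in>E. \<forall>x\<in>B. d t x = 0,
     \<forall>t\<in>E. \<forall>x\<in>B. d x t = 0,
     \<forall>t\<in>E. \<forall>x\<in>B. d x t + d t x = 0,
     \<exists>x\<in>B. x \<noteq> 0 \<and> d x x = 0,
     \<exists>x\<in>B. x \<noteq> 0 \<and> (\<forall>y\<in>B. d x y = 0)]"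

lemma equivalent_invariants:
  assumes "equivalent_codiff scale V d d'"
  shows "invariants (V 0) (V 1) d = invariants (V 0) (V 1) d'"
proof -
  obtain g where g: "even_automorphism scale V g" and d': "d' = (\<lambda>x y. inv g (d (g x) (g y)))"
    using assms unfolding equivalent_codiff_def by blast
  have bij: "bij g" using g unfolding even_automorphism_def by blast
  have int: "d (g x) (g y) = g (d' x y)" for x y
    unfolding d' using bij by (simp add: bij_def surj_f_inv_f)
  have lin: "g x + g y = g (x + y)" for x y
    using g unfolding even_automorphism_def by (metis Vector_Spaces.linear.axioms(3) module_hom.add)
  have inj: "g x = g y \<longleftrightarrow> x = y" for x y using bij by (simp add: bij_def inj_eq)
  have "g 0 = 0" using lin[of 0 0] by simp
  then have zero: "g x = 0 \<longleftrightarrow> x = 0" for x using inj by metis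
  have "invariants (V 0) (V 1) d = invariants (g ` V 0) (g ` V 1) d"
    using even_automorphism_image[OF g] by simp
  also have "\<dots> = invariants (V 0) (V 1) d'"
    unfolding invariants_def by (simp add: int lin inj zero)
  finally show ?thesis .
qed

text \<open>By trilinearity. It turns the third invariant into a finite check on concrete
  constants.\<close>

lemma nilpotent_on_basis:
  assumes "bilinear_op scale d"
  shows "(\<forall>x\<in>V 1. \<forall>y\<in>V 1. \<forall>z\<in>V 1. d (d x y) z = 0) \<longleftrightarrow>
    (\<forall>x\<in>{vec 0 1 0, vec 0 0 1}. \<forall>y\<in>{vec 0 1 0, vec 0 0 1}. \<forall>z\<in>{vec 0 1 0, vec 0 0 1}. d (d x y) z = 0)"
    (is "?l \<longleftrightarrow> ?r")
proof
  assume ?l then show ?r by (simp add: mem_V)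
next
  note bilin = bilinear_op_simps[OF assms]
  have v: "vec 0 b c = b *s vec 0 1 0 + c *s vec 0 0 1" for b c
    by (simp add: vec_arith)
  assume r: ?r
  define n where "n = vec 0 1 0"
  define e where "e = vec 0 0 1"
  have "d (d (b *s n + c *s e) (b' *s n + c' *s e)) (b'' *s n + c'' *s e) = 0" for b c b' c' b'' c''
    using r unfolding n_def[symmetric] e_def[symmetric] by (simp add: bilin)
  then show ?l unfolding all_V by (subst v, subst v, subst v) (simp add: n_def e_def)
qed

text \<open>A bilinear form in free coordinates vanishes identically iff its coefficients do, so
  each universal entry becomes a condition on the constants.\<close>

lemma invariants_tab:
  "invariants (V 0) (V 1) (tab L) =
    [L!6 = 0 \<and> L!7 = 0 \<and> L!8 = 0 \<and> L!9 = 0 \<and> L!10 = 0 \<and> L!11 = 0 \<and> L!12 = 0 \<and> L!13 = 0,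
     L!8 = L!10 \<and> L!9 = L!11,
     \<forall>x\<in>{vec 0 1 0, vec 0 0 1}. \<forall>y\<in>{vec 0 1 0, vec 0 0 1}. \<forall>z\<in>{vec 0 1 0, vec 0 0 1}. tab L (tab L x y) z = 0,
     L!0 = 0 \<and> L!1 = 0,
     L!2 = 0 \<and> L!3 = 0,
     L!4 = 0 \<and> L!5 = 0,
     L!2 + L!4 = 0 \<and> L!3 + L!5 = 0,
     \<exists>b c. (b \<noteq> 0 \<or> c \<noteq> 0) \<and> L!6 * (b * b) + (L!8 + L!10) * (b * c) + L!12 * (c * c) = 0 \<and>
       L!7 * (b * b) + (L!9 + L!11) * (b * c) + L!13 * (c * c) = 0,
     \<exists>b c. (b \<noteq> 0 \<or> c \<noteq> 0) \<and> L!6 * b + L!10 * c = 0 \<and> L!8 * b + L!12 * c = 0 \<and>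
       L!7 * b + L!11 * c = 0 \<and> L!9 * b + L!13 * c = 0]"
proof -
  have lin: "(\<forall>b c. p * b + q * c = 0) \<longleftrightarrow> p = 0 \<and> q = 0" for p q :: complex
    by (metis add.right_neutral add.left_neutral mult_1_right mult_zero_right mult_zero_left)
  have bil: "(\<forall>b c b' c'. p * (b * b') + q * (b * c') + r * (c * b') + s * (c * c') = 0)
    \<longleftrightarrow> p = 0 \<and> q = 0 \<and> r = 0 \<and> s = 0" for p q r s :: complex
  proof -
    have "(\<forall>b c b' c'. p * (b * b') + q * (b * c') + r * (c * b') + s * (c * c') = 0) \<Longrightarrow>
       p = 0 \<and> q = 0 \<and> r = 0 \<and> s = 0"
      by (metis add.right_neutral add.left_neutral mult_1_right mult_zero_left mult_zero_right)
    then show ?thesis by auto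
  qed
  have 1: "(\<forall>x\<in>V 1. \<forall>y\<in>V 1. tab L x y = 0) \<longleftrightarrow>
    L!6 = 0 \<and> L!7 = 0 \<and> L!8 = 0 \<and> L!9 = 0 \<and> L!10 = 0 \<and> L!11 = 0 \<and> L!12 = 0 \<and> L!13 = 0"
    unfolding all_V tab_vec vec_0(1) by (simp add: all_conj_distrib bil) blast
  have "(\<forall>x\<in>V 1. \<forall>y\<in>V 1. tab L x y = tab L y x) \<longleftrightarrow>
    (\<forall>b c b' c'. (L!8 - L!10) * (b * c' - c * b') = 0 \<and> (L!9 - L!11) * (b * c' - c * b') = 0)"
    unfolding all_V tab_vec vec_eq_iff by (simp only: right_diff_distrib left_diff_distrib) (simp add: algebra_simps)
  also have "\<dots> \<longleftrightarrow> L!8 = L!10 \<and> L!9 = L!11"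
  proof
    assume "\<forall>b c b' c'. (L!8 - L!10) * (b * c' - c * b') = 0 \<and> (L!9 - L!11) * (b * c' - c * b') = 0"
    then have "(L!8 - L!10) * (1 * 1 - 0 * 0) = 0 \<and> (L!9 - L!11) * (1 * 1 - 0 * 0) = 0" by blast
    then show "L!8 = L!10 \<and> L!9 = L!11" by simp
  qed simp
  finally have 2: "(\<forall>x\<in>V 1. \<forall>y\<in>V 1. tab L x y = tab L y x) \<longleftrightarrow> L!8 = L!10 \<and> L!9 = L!11" .
  have 4: "(\<forall>t\<in>V 0. tab L t t = 0) \<longleftrightarrow> L!0 = 0 \<and> L!1 = 0"
    unfolding all_V tab_vec vec_0(1) by (auto dest: spec[of _ 1])
  have 5: "(\<forall>t\<in>V 0. \<forall>x\<in>V 1. tab L t x = 0) \<longleftrightarrow> L!2 = 0 \<and> L!3 = 0"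
    unfolding all_V tab_vec vec_0(1) lin[symmetric] by (auto dest: spec[of _ 1])
  have 6: "(\<forall>t\<in>V 0. \<forall>x\<in>V 1. tab L x t = 0) \<longleftrightarrow> L!4 = 0 \<and> L!5 = 0"
    unfolding all_V tab_vec vec_0(1) lin[symmetric] by (auto dest: spec[of _ 1])
  have "(\<forall>t\<in>V 0. \<forall>x\<in>V 1. tab L x t + tab L t x = 0) \<longleftrightarrow>
    (\<forall>a b c. a * ((L!2 + L!4) * b + (L!3 + L!5) * c) = 0)"
    unfolding all_V tab_vec vec_arith vec_0(1) by (simp only: mult_zero_left mult_zero_right add_0_left add_0_right) (simp add: algebra_simps)
  also have "\<dots> \<longleftrightarrow> L!2 + L!4 = 0 \<and> L!3 + L!5 = 0"
    unfolding lin[symmetric] by (auto dest: spec[of _ 1])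
  finally have 7: "(\<forall>t\<in>V 0. \<forall>x\<in>V 1. tab L x t + tab L t x = 0) \<longleftrightarrow> L!2 + L!4 = 0 \<and> L!3 + L!5 = 0" .
  have 8: "(\<exists>x\<in>V 1. x \<noteq> 0 \<and> tab L x x = 0) \<longleftrightarrow>
     (\<exists>b c. (b \<noteq> 0 \<or> c \<noteq> 0) \<and> L!6 * (b * b) + (L!8 + L!10) * (b * c) + L!12 * (c * c) = 0 \<and>
       L!7 * (b * b) + (L!9 + L!11) * (b * c) + L!13 * (c * c) = 0)"
    unfolding ex_V tab_vec vec_0(1) by (simp add: algebra_simps)
  have *: "(\<forall>y\<in>V 1. tab L (vec 0 b c) y = 0) \<longleftrightarrow> L!6 * b + L!10 * c = 0 \<and> L!8 * b + L!12 * c = 0 \<and>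
       L!7 * b + L!11 * c = 0 \<and> L!9 * b + L!13 * c = 0" for b c
  proof -
    have "(\<forall>y\<in>V 1. tab L (vec 0 b c) y = 0) \<longleftrightarrow> (\<forall>b' c'. (L!6 * b + L!10 * c) * b' + (L!8 * b + L!12 * c) * c' = 0) \<and>
      (\<forall>b' c'. (L!7 * b + L!11 * c) * b' + (L!9 * b + L!13 * c) * c' = 0)"
      unfolding all_V tab_vec vec_0(1) by (simp add: algebra_simps all_conj_distrib)
    then show ?thesis unfolding lin by blast
  qed
  have 9: "(\<exists>x\<in>V 1. x \<noteq> 0 \<and> (\<forall>y\<in>V 1. tab L x y = 0)) \<longleftrightarrow>
     (\<exists>b c. (b \<noteq> 0 \<or> c \<noteq> 0) \<and> L!6 * b + L!10 * c = 0 \<and> L!8 * b + L!12 * c = 0 \<and>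
       L!7 * b + L!11 * c = 0 \<and> L!9 * b + L!13 * c = 0)"
    unfolding ex_V * vec_0(1) by simp
  show ?thesis
    unfolding invariants_def 1 2 4 5 6 7 8 9 nilpotent_on_basis[OF bilinear_tab] ..
qed

text \<open>Equivalent products share their invariants, so this separates all 28 forms.\<close>

lemma distinct_invariants: "distinct (map (\<lambda>L. invariants (V 0) (V 1) (tab L)) normal_forms)"
proof -
  have ex: "\<exists>b::complex. b \<noteq> 0" "\<exists>b c::complex. b \<noteq> 0 \<or> c \<noteq> 0" using one_neq_zero by metis+
  show ?thesis
    unfolding normal_forms_def list.map invariants_tab
    by (simp add: ex tab_vec vec_0(1) vec_eq_iff cong: conj_cong)
qed

section \<open>Normal forms\<close>

text \<open>The order of \<open>L\<close> is that of \<open>tab\<close>, with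
  \<open>\<theta>\<close>, \<open>n\<close>, \<open>e\<close> in the roles of v_1, v_2, v_3.
  Normalization can thus change the adapted basis and leave \<open>d\<close> fixed.\<close>

definition has_constants :: "('v \<Rightarrow> 'v \<Rightarrow> 'v) \<Rightarrow> 'v \<Rightarrow> 'v \<Rightarrow> 'v \<Rightarrow> complex list \<Rightarrow> bool" where
  "has_constants d \<theta> n e L \<longleftrightarrow> \<theta> \<in> V 0 \<and> \<theta> \<noteq> 0 \<and> pair_basis (V 1) n e \<and>
     d \<theta> \<theta> = L!0 *s n + L!1 *s e \<and> d \<theta> n = L!2 *s \<theta> \<and> d \<theta> e = L!3 *s \<theta> \<and>
     d n \<theta> = L!4 *s \<theta> \<and> d e \<theta> = L!5 *s \<theta> \<and>
     d n n = L!6 *s n + L!7 *s e \<and> d n e = L!8 *s n + L!9 *s e \<and>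
     d e n = L!10 *s n + L!11 *s e \<and> d e e = L!12 *s n + L!13 *s e"

lemma even_part_spanned:
  assumes "x \<in> V 0" "\<theta> \<in> V 0" "\<theta> \<noteq> 0"
  shows "\<exists>k. x = k *s \<theta>"
proof -
  obtain a b where "x = vec a 0 0" "\<theta> = vec b 0 0" "b \<noteq> 0" using assms by (auto simp: V_cases vec_0(1))
  then have "x = (a / b) *s \<theta>" by (simp add: vec_arith)
  then show ?thesis by blast
qed

text \<open>The linear map sending v_1, v_2, v_3 to \<open>\<theta>\<close>, \<open>n\<close>,
  \<open>e\<close> is bijective and even, and it intertwines \<open>tab L\<close> with
  \<open>d\<close>.\<close>

lemma equivalent_tab:
  assumes d: "bilinear_op scale d" and frame: "has_constants d \<theta> n e L"
  shows "equivalent_codiff scale V d (tab L)"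
proof -
  define g where "g x = crd 1 x *s \<theta> + crd 2 x *s n + crd 3 x *s e" for x
  have g: "g (vec a b c) = a *s \<theta> + (b *s n + c *s e)" for a b c
    unfolding g_def crd_vec by (simp add: add.assoc)
  have \<theta>: "\<theta> \<in> V 0" "\<theta> \<noteq> 0" and ne: "pair_basis (V 1) n e"
    using frame by (auto simp: has_constants_def)
  have nV: "n \<in> V 1" "e \<in> V 1" using ne by (auto simp: pair_basis_def)
  have add: "g (x + y) = g x + g y" and scale: "g (k *s x) = k *s g x" for x y k
    by (rule vec_cases[of x], rule vec_cases[of y],
        simp add: vec_arith g scale_left_distrib scale_right_distrib ac_simps)+
  have ker: "x = 0" if "g x = 0" for x
  proof -
    obtain a b c where x: "x = vec a b c" by (rule vec_cases)
    have 0: "a *s \<theta> + (b *s n + c *s e) = 0" using that unfolding x g .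
    have "b *s n + c *s e \<in> V 1" using nV subspace_V by (simp add: subspace_add subspace_scale)
    moreover have "a *s \<theta> \<in> V 0" using \<theta> subspace_V by (simp add: subspace_scale)
    moreover have "a *s \<theta> = - (b *s n + c *s e)" using 0 by (simp only: eq_neg_iff_add_eq_0)
    ultimately have "a *s \<theta> \<in> V 1" using subspace_V subspace_neg by metis
    then have "a *s \<theta> = 0" using V_disjoint \<open>a *s \<theta> \<in> V 0\<close> by blast
    then have "a = 0" "b *s n + c *s e = 0" using \<theta> 0 by simp_all
    then show ?thesis using ne unfolding x vec_0(1) pair_basis_def by blast
  qed
  have "inj g"
  proof (rule injI)
    fix x y assume "g x = g y"
    then have "g (x + (- 1) *s y) = 0" unfolding add scale by simp
    then show "x = y" using ker by fastforce
  qed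
  moreover have "surj g"
  proof (rule surjI)
    fix y
    show "g (SOME x. g x = y) = y"
    proof (rule someI_ex)
      obtain a b c where y: "y = vec a b c" by (rule vec_cases)
      obtain k where "vec a 0 0 = k *s \<theta>" using even_part_spanned \<theta> mem_V by blast
      moreover obtain p q where "vec 0 b c = p *s n + q *s e"
        using ne mem_V unfolding pair_basis_def by blast
      moreover have "y = vec a 0 0 + vec 0 b c" by (simp add: y vec_arith)
      ultimately show "\<exists>x. g x = y" using g by metis
    qed
  qed
  ultimately have bij: "bij g" by (simp add: bij_def)
  have "\<forall>p. \<forall>x\<in>V p. g x \<in> V p"
    unfolding all_bit all_V using \<theta> nV subspace_V by (simp add: g subspace_add subspace_scale)
  then have "g ` V p \<subseteq> V p" for p by blast
  then have "even_automorphism scale V g"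
    unfolding even_automorphism_def using bij add scale by (auto intro: linear_intro)
  moreover have "g (tab L x y) = d (g x) (g y)" for x y
  proof -
    obtain a b c a' b' c' where xy: "x = vec a b c" "y = vec a' b' c'" using vec_cases by metis
    show ?thesis
      using frame unfolding xy tab_vec g has_constants_def
      by (simp add: bilinear_op_simps[OF d] scale_left_distrib scale_right_distrib ac_simps)
  qed
  then have "tab L = (\<lambda>x y. inv g (d (g x) (g y)))"
    using \<open>inj g\<close> by (metis inv_f_f)
  ultimately show ?thesis unfolding equivalent_codiff_def by blast
qed

section \<open>Changes of adapted basis and the structure equations\<close>

lemma has_constants_rescale:
  assumes d: "bilinear_op scale d" and frame: "has_constants d \<theta> n e L" and "t \<noteq> 0" "a \<noteq> 0" "b \<noteq> 0"
  shows "has_constants d (t *s \<theta>) (a *s n) (b *s e)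
    [t * t * L!0 / a, t * t * L!1 / b, a * L!2, b * L!3, a * L!4, b * L!5, a * L!6, a * a * L!7 / b,
     b * L!8, a * L!9, b * L!10, a * L!11, b * b * L!12 / a, b * L!13]"
proof -
  have "pair_basis (V 1) (a *s n + 0 *s e) (0 *s n + b *s e)"
    using frame assms(4,5) by (intro pair_basis_transform[OF subspace_V]) (auto simp: has_constants_def)
  then show ?thesis
    using frame assms(3-) subspace_V
    by (simp add: has_constants_def bilinear_op_simps[OF d] scale_right_distrib subspace_scale ac_simps)
qed

lemma has_constants_swap:
  assumes "has_constants d \<theta> n e L"
  shows "has_constants d \<theta> e n
    [L!1, L!0, L!3, L!2, L!5, L!4, L!13, L!12, L!11, L!10, L!9, L!8, L!7, L!6]"
  using assms pair_basis_swap unfolding has_constants_def by (simp add: add.commute)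

text \<open>Each group is the codifferential identity for one type of triple, with x and y in
  {\<open>n\<close>, \<open>e\<close>}: x y \<open>\<theta>\<close> (left character),
  \<open>\<theta>\<close> x y (right character, with a sign), x \<open>\<theta>\<close>
  \<open>\<theta>\<close>, \<open>\<theta>\<close> \<open>\<theta>\<close> x, and
  \<open>\<theta>\<close> x \<open>\<theta>\<close>, which forces the characters to be opposite when
  the square of \<open>\<theta>\<close> is nonzero.\<close>

lemma structure_equations:
  assumes d: "odd_codifferential scale V d" and frame: "has_constants d \<theta> n e L"
  shows "L!6 * L!4 + L!7 * L!5 = L!4 * L!4" "L!8 * L!4 + L!9 * L!5 = L!4 * L!5"
    "L!10 * L!4 + L!11 * L!5 = L!5 * L!4" "L!12 * L!4 + L!13 * L!5 = L!5 * L!5"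
    "L!6 * L!2 + L!7 * L!3 = - (L!2 * L!2)" "L!8 * L!2 + L!9 * L!3 = - (L!2 * L!3)"
    "L!10 * L!2 + L!11 * L!3 = - (L!3 * L!2)" "L!12 * L!2 + L!13 * L!3 = - (L!3 * L!3)"
    "L!4 * L!0 = L!0 * L!6 + L!1 * L!8" "L!4 * L!1 = L!0 * L!7 + L!1 * L!9"
    "L!5 * L!0 = L!0 * L!10 + L!1 * L!12" "L!5 * L!1 = L!0 * L!11 + L!1 * L!13"
    "L!0 * L!6 + L!1 * L!10 = - (L!2 * L!0)" "L!0 * L!7 + L!1 * L!11 = - (L!2 * L!1)"
    "L!0 * L!8 + L!1 * L!12 = - (L!3 * L!0)" "L!0 * L!9 + L!1 * L!13 = - (L!3 * L!1)"
    "(L!2 + L!4) * L!0 = 0" "(L!2 + L!4) * L!1 = 0" "(L!3 + L!5) * L!0 = 0" "(L!3 + L!5) * L!1 = 0"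
proof -
  have bil: "bilinear_op scale d" using d by (simp add: odd_codifferential_def)
  note b = bilinear_op_simps[OF bil]
  have \<theta>: "\<theta> \<in> V 0" "\<theta> \<noteq> 0" and ne: "pair_basis (V 1) n e"
    and prods: "d \<theta> \<theta> = L!0 *s n + L!1 *s e" "d \<theta> n = L!2 *s \<theta>" "d \<theta> e = L!3 *s \<theta>"
     "d n \<theta> = L!4 *s \<theta>" "d e \<theta> = L!5 *s \<theta>"
     "d n n = L!6 *s n + L!7 *s e" "d n e = L!8 *s n + L!9 *s e"
     "d e n = L!10 *s n + L!11 *s e" "d e e = L!12 *s n + L!13 *s e"
    using frame by (auto simp: has_constants_def)
  have nV: "n \<in> V 1" "e \<in> V 1" using ne by (auto simp: pair_basis_def)
  have co: "d (d x y) z + parity_sign p *s d x (d y z) = 0" if "x \<in> V p" "y \<in> V q" "z \<in> V r" for p q r x y z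
    using d that unfolding odd_codifferential_def by blast
  have even: "d (d \<theta> y) z + d \<theta> (d y z) = 0" if "y \<in> V q" "z \<in> V r" for q r y z
    using co[OF \<theta>(1) that] by (simp add: parity_sign_def)
  have odd: "d (d x y) z = d x (d y z)" if "x \<in> V 1" "y \<in> V q" "z \<in> V r" for q r x y z
    using co[OF that] by (simp add: parity_sign_def)
  have t: "k *s \<theta> = l *s \<theta> \<longleftrightarrow> k = l" for k l using \<theta> by simp
  have t0: "k *s \<theta> = 0 \<longleftrightarrow> k = 0" for k using \<theta> by simp
  note eq = pair_basis_coeff_eq[OF ne]
  have eq0: "k *s n + l *s e = 0 \<longleftrightarrow> k = 0 \<and> l = 0" for k l using eq[of k l 0 0] by simp
  have l: "(p * L!4 + q * L!5) = x * y" if "d (p *s n + q *s e) \<theta> = (x * y) *s \<theta>" for p q x y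
  proof -
    have "(p * L!4 + q * L!5) *s \<theta> = (x * y) *s \<theta>" using that by (simp add: b prods scale_left_distrib)
    then show ?thesis unfolding t .
  qed
  show "L!6 * L!4 + L!7 * L!5 = L!4 * L!4"
    using odd[OF nV(1) nV(1) \<theta>(1)] by (intro l) (simp add: prods b)
  show "L!8 * L!4 + L!9 * L!5 = L!4 * L!5"
    using odd[OF nV(1) nV(2) \<theta>(1)] by (intro l) (simp add: prods b mult.commute)
  show "L!10 * L!4 + L!11 * L!5 = L!5 * L!4"
    using odd[OF nV(2) nV(1) \<theta>(1)] by (intro l) (simp add: prods b mult.commute)
  show "L!12 * L!4 + L!13 * L!5 = L!5 * L!5"
    using odd[OF nV(2) nV(2) \<theta>(1)] by (intro l) (simp add: prods b)
  have r: "p * L!2 + q * L!3 = - (x * y)" if "(x * y) *s \<theta> + d \<theta> (p *s n + q *s e) = 0" for p q x y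
  proof -
    have "(x * y + (p * L!2 + q * L!3)) *s \<theta> = 0" using that by (simp add: b prods scale_left_distrib)
    then show ?thesis unfolding t0 by (simp add: eq_neg_iff_add_eq_0 add.commute)
  qed
  show "L!6 * L!2 + L!7 * L!3 = - (L!2 * L!2)"
    using even[OF nV(1) nV(1)] by (intro r) (simp add: prods b)
  show "L!8 * L!2 + L!9 * L!3 = - (L!2 * L!3)"
    using even[OF nV(1) nV(2)] by (intro r) (simp add: prods b)
  show "L!10 * L!2 + L!11 * L!3 = - (L!3 * L!2)"
    using even[OF nV(2) nV(1)] by (intro r) (simp add: prods b)
  show "L!12 * L!2 + L!13 * L!3 = - (L!3 * L!3)"
    using even[OF nV(2) nV(2)] by (intro r) (simp add: prods b)
  have "d (d n \<theta>) \<theta> = d n (d \<theta> \<theta>)" "d (d e \<theta>) \<theta> = d e (d \<theta> \<theta>)" using odd nV \<theta>(1) by blast+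
  then have "(L!4 * L!0) *s n + (L!4 * L!1) *s e = (L!0 * L!6 + L!1 * L!8) *s n + (L!0 * L!7 + L!1 * L!9) *s e"
    "(L!5 * L!0) *s n + (L!5 * L!1) *s e = (L!0 * L!10 + L!1 * L!12) *s n + (L!0 * L!11 + L!1 * L!13) *s e"
    by (simp_all add: b prods scale_left_distrib scale_right_distrib ac_simps)
  then show "L!4 * L!0 = L!0 * L!6 + L!1 * L!8" "L!4 * L!1 = L!0 * L!7 + L!1 * L!9"
    "L!5 * L!0 = L!0 * L!10 + L!1 * L!12" "L!5 * L!1 = L!0 * L!11 + L!1 * L!13"
    unfolding eq by blast+
  have "d (d \<theta> \<theta>) n + d \<theta> (d \<theta> n) = 0" "d (d \<theta> \<theta>) e + d \<theta> (d \<theta> e) = 0" using even nV \<theta>(1) by blast+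
  then have "(L!0 * L!6 + L!1 * L!10 + L!2 * L!0) *s n + (L!0 * L!7 + L!1 * L!11 + L!2 * L!1) *s e = 0"
    "(L!0 * L!8 + L!1 * L!12 + L!3 * L!0) *s n + (L!0 * L!9 + L!1 * L!13 + L!3 * L!1) *s e = 0"
    by (simp_all add: b prods scale_left_distrib scale_right_distrib ac_simps)
  then show "L!0 * L!6 + L!1 * L!10 = - (L!2 * L!0)" "L!0 * L!7 + L!1 * L!11 = - (L!2 * L!1)"
    "L!0 * L!8 + L!1 * L!12 = - (L!3 * L!0)" "L!0 * L!9 + L!1 * L!13 = - (L!3 * L!1)"
    unfolding eq0 by (simp_all add: eq_neg_iff_add_eq_0)
  have "d (d \<theta> n) \<theta> + d \<theta> (d n \<theta>) = 0" "d (d \<theta> e) \<theta> + d \<theta> (d e \<theta>) = 0" using even nV \<theta>(1) by blast+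
  then have "(L!2 + L!4) *s d \<theta> \<theta> = 0" "(L!3 + L!5) *s d \<theta> \<theta> = 0"
    by (simp_all only: b prods(2-5) scale_left_distrib)
  then show "(L!2 + L!4) * L!0 = 0" "(L!2 + L!4) * L!1 = 0" "(L!3 + L!5) * L!0 = 0" "(L!3 + L!5) * L!1 = 0"
    unfolding prods(1) scale_right_distrib scale_scale eq0 by blast+
qed

text \<open>On odd arguments the sign in the codifferential identity is -1, so \<open>d\<close> is
  associative on \<open>V 1\<close> and the plane classification applies. A plane table is exactly
  the tail of the constant list from position 6 on; the square of \<open>\<theta>\<close> and the
  two actions fill positions 0 to 5.\<close>

lemma exists_frame:
  assumes d: "odd_codifferential scale V d"
  obtains \<theta> n e u2 u3 r2 r3 l2 l3 cs where "has_constants d \<theta> n e ([u2, u3, r2, r3, l2, l3] @ cs)"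
    "cs \<in> {[1,0,0,0,0,0,0,1], [0,0,1,0,1,0,0,1], [0,0,0,0,0,0,0,1], [0,0,0,0,1,0,0,1],
      [0,0,1,0,0,0,0,1], [0,0,0,0,0,0,1,0], [0,0,0,0,0,0,0,0]}"
proof -
  have bil: "bilinear_op scale d" and odd: "op_of_parity V 1 d" using d by (simp_all add: odd_codifferential_def)
  have par: "d x y \<in> V (p + q + 1)" if "x \<in> V p" "y \<in> V q" for x y p q
    using odd that unfolding op_of_parity_def by blast
  interpret B: plane_algebra scale "V 1" d
  proof
    fix x y z assume "x \<in> V 1" "y \<in> V 1" "z \<in> V 1"
    then have "d (d x y) z + parity_sign 1 *s d x (d y z) = 0"
      using d unfolding odd_codifferential_def by blast
    then show "d (d x y) z = d x (d y z)" by (simp add: parity_sign_def)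
  qed (use subspace_V bil par[of _ 1 _ 1] in auto)
  have "pair_basis (V 1) (vec 0 1 0) (vec 0 0 1)"
    by (auto simp: pair_basis_def mem_V vec_arith vec_0(1) V_cases)
  from B.plane_classification[OF this] obtain n e cs where t: "B.table n e cs"
    and cs: "cs \<in> {[1,0,0,0,0,0,0,1], [0,0,1,0,1,0,0,1], [0,0,0,0,0,0,0,1], [0,0,0,0,1,0,0,1],
      [0,0,1,0,0,0,0,1], [0,0,0,0,0,0,1,0], [0,0,0,0,0,0,0,0]}"
    by blast
  have ne: "pair_basis (V 1) n e" using t by (simp add: B.table_def)
  then have nV: "n \<in> V 1" "e \<in> V 1" by (auto simp: pair_basis_def)
  define \<theta> where "\<theta> = vec 1 0 0"
  have \<theta>: "\<theta> \<in> V 0" "\<theta> \<noteq> 0" by (simp_all add: \<theta>_def mem_V vec_0(1))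
  have "d \<theta> \<theta> \<in> V 1" using par[OF \<theta>(1) \<theta>(1)] by simp
  then obtain u2 u3 where u: "d \<theta> \<theta> = u2 *s n + u3 *s e" using ne unfolding pair_basis_def by blast
  have ex: "\<exists>k. d \<theta> x = k *s \<theta>" "\<exists>k. d x \<theta> = k *s \<theta>" if "x \<in> V 1" for x
    using par[OF \<theta>(1) that] par[OF that \<theta>(1)] \<theta> even_part_spanned by auto
  obtain r2 r3 l2 l3 where "d \<theta> n = r2 *s \<theta>" "d \<theta> e = r3 *s \<theta>" "d n \<theta> = l2 *s \<theta>" "d e \<theta> = l3 *s \<theta>"
    using ex nV by metis
  then have "has_constants d \<theta> n e ([u2, u3, r2, r3, l2, l3] @ cs)"
    using \<theta> ne u t by (simp add: has_constants_def B.table_def)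
  then show thesis using that cs by blast
qed

text \<open>Disposes of the null algebra with trivial square, which has no normal form.\<close>

lemma zero_table:
  assumes "bilinear_op scale d" "has_constants d \<theta> n e [0,0,0,0,0,0,0,0,0,0,0,0,0,0]"
  shows "d = 0"
proof -
  obtain g where g: "even_automorphism scale V g"
    "tab [0,0,0,0,0,0,0,0,0,0,0,0,0,0] = (\<lambda>x y. inv g (d (g x) (g y)))"
    using equivalent_tab[OF assms] unfolding equivalent_codiff_def by blast
  have bij: "bij g" and "Vector_Spaces.linear scale scale g"
    using g(1) unfolding even_automorphism_def by blast+
  note hom = Vector_Spaces.linear.axioms(3)[OF this(2)]
  have "d (g x) (g y) = 0" for x y
  proof -
    have "inv g (d (g x) (g y)) = 0"
      using fun_cong[OF fun_cong[OF g(2)], of x y] by (simp add: tab_def vec_0(2)[symmetric])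
    then show ?thesis using module_hom.zero[OF hom] bij by (metis bij_inv_eq_iff)
  qed
  then have "d x y = 0" for x y using bij by (metis bij_pointE)
  then show ?thesis by (simp add: fun_eq_iff)
qed

text \<open>Replacing \<open>\<theta>\<close> by \<open>t *s \<theta>\<close> multiplies its square
  by \<open>t * t\<close> and leaves the actions unchanged, so a complex square root adjusts the
  square to any nonzero scalar.\<close>

lemma exists_square_scaling:
  assumes "u \<noteq> 0" "k \<noteq> (0::complex)"
  obtains t where "t \<noteq> 0" "t * t * u = k"
proof
  show "csqrt (k / u) \<noteq> 0" using assms by simp
  show "csqrt (k / u) * csqrt (k / u) * u = k"
    using assms power2_csqrt[of "k / u"] by (simp add: power2_eq_square)
qed

text \<open>For each of the seven plane tables the structure equations leave finitely many pairs of
  characters and at most one line for the square of \<open>\<theta>\<close> once it is nonzero,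
  except over the null algebra, where any nonzero square can serve as a basis vector.\<close>

theorem exists_normal_form:
  assumes d: "odd_codifferential scale V d" and "d \<noteq> 0"
  shows "\<exists>L\<in>set normal_forms. equivalent_codiff scale V d (tab L)"
proof -
  have bil: "bilinear_op scale d" using d by (simp add: odd_codifferential_def)
  obtain \<theta> n e u2 u3 r2 r3 l2 l3 cs where h: "has_constants d \<theta> n e ([u2, u3, r2, r3, l2, l3] @ cs)"
    and cs: "cs \<in> {[1,0,0,0,0,0,0,1], [0,0,1,0,1,0,0,1], [0,0,0,0,0,0,0,1], [0,0,0,0,1,0,0,1],
      [0,0,1,0,0,0,0,1], [0,0,0,0,0,0,1,0], [0,0,0,0,0,0,0,0]}"
    using exists_frame[OF d] .
  have goal: ?thesis if "has_constants d \<theta> n e L" "L \<in> set normal_forms" for \<theta> n e L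
    using equivalent_tab[OF bil that(1)] that(2) by blast
  note eqs = structure_equations[OF d h]
  consider (CC) "cs = [1,0,0,0,0,0,0,1]" | (dual) "cs = [0,0,1,0,1,0,0,1]" | (C0) "cs = [0,0,0,0,0,0,0,1]"
    | (left) "cs = [0,0,0,0,1,0,0,1]" | (right) "cs = [0,0,1,0,0,0,0,1]" | (nil) "cs = [0,0,0,0,0,0,1,0]"
    | (null) "cs = [0,0,0,0,0,0,0,0]" using cs by blast
  then show ?thesis
  proof cases
    case CC
    note h = h[unfolded CC, simplified]
    note eqs = eqs[unfolded CC, simplified]
    have *: ?thesis if "has_constants d \<theta> n e [0, u, 0, -1, 0, 1, 1, 0, 0, 0, 0, 0, 0, 1]" "u \<noteq> 0" for \<theta> n e u
    proof -
      \<comment> \<open>In d_1 the vector v_3 is the negative of an idempotent. Hence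
        \<open>e\<close> is replaced by \<open>- e\<close> below, and \<open>t * t * u = -1\<close>
        gives the new coefficient (-1)/(-1) = 1.\<close>
      obtain t where t: "t \<noteq> 0" "t * t * u = -1" using exists_square_scaling[OF \<open>u \<noteq> 0\<close>, of "-1"] by auto
      show ?thesis
        by (rule goal[OF has_constants_rescale[OF bil that(1) t(1), of 1 "-1"]]) (simp_all add: t normal_forms_def)
    qed
    consider "u2 \<noteq> 0" | "u3 \<noteq> 0" | "u2 = 0" "u3 = 0" by blast
    then show ?thesis
    proof cases
      case 1
      then have "l2 = 1" "l3 = 0" "r2 = -1" "r3 = 0" "u3 = 0" using eqs by (auto simp: eq_neg_iff_add_eq_0)
      then show ?thesis using *[OF _ 1] has_constants_swap[OF h] by simp
    next
      case 2
      then have "l2 = 0" "l3 = 1" "r2 = 0" "r3 = -1" "u2 = 0" using eqs by (auto simp: eq_neg_iff_add_eq_0)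
      then show ?thesis using *[OF _ 2] h by simp
    next
      case 3
      have l: "l2 = 0 \<and> l3 = 0 \<or> l2 = 0 \<and> l3 = 1 \<or> l2 = 1 \<and> l3 = 0" using eqs by auto
      have "(r2 + 1) * r2 = 0" "(r3 + 1) * r3 = 0" "r2 * r3 = 0"
        using eqs by (auto simp: distrib_right eq_neg_iff_add_eq_0 add.commute)
      then have r: "r2 = 0 \<and> r3 = 0 \<or> r2 = 0 \<and> r3 = -1 \<or> r2 = -1 \<and> r3 = 0"
        by (auto simp: add_eq_0_iff2)
      \<comment> \<open>Three left and three right characters make nine pairs; exchanging the two
        idempotents identifies them down to the five forms d_3 to d_7.\<close>
      have "[0, 0, r2, r3, l2, l3, 1, 0, 0, 0, 0, 0, 0, 1] \<in> set normal_forms \<or>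
        [0, 0, r3, r2, l3, l2, 1, 0, 0, 0, 0, 0, 0, 1] \<in> set normal_forms"
        using l r by (elim disjE) (simp_all add: normal_forms_def)
      then show ?thesis
        using goal[OF h] goal[OF has_constants_swap[OF h]] unfolding 3 by auto
    qed
  next
    case dual
    note h = h[unfolded dual, simplified]
    note eqs = eqs[unfolded dual, simplified]
    \<comment> \<open>A character vanishes on the nilpotent \<open>n\<close>, and \<open>n\<close>
      then annihilates the square of \<open>\<theta>\<close>, which rules out a component along
      \<open>e\<close>.\<close>
    have 0: "l2 = 0" "r2 = 0" "u3 = 0" using eqs by auto
    show ?thesis
    proof (cases "u2 = 0")
      case True
      have l: "l3 = 0 \<or> l3 = 1" using eqs by auto
      have "(r3 + 1) * r3 = 0" using eqs by (simp add: distrib_right eq_neg_iff_add_eq_0 add.commute)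
      then have r: "r3 = 0 \<or> r3 = -1" by (auto simp: add_eq_0_iff2)
      have "[0, 0, 0, r3, 0, l3, 0, 0, 1, 0, 1, 0, 0, 1] \<in> set normal_forms"
        using l r by (elim disjE) (simp_all add: normal_forms_def)
      then show ?thesis using goal[OF h] unfolding True 0 by blast
    next
      case False
      then have "l3 = 1" "r3 = -1" using eqs by (auto simp: eq_neg_iff_add_eq_0)
      note h = h[unfolded this 0]
      obtain t where t: "t \<noteq> 0" "t * t * u2 = 1" using exists_square_scaling[OF False, of 1] by auto
      show ?thesis
        by (rule goal[OF has_constants_rescale[OF bil h t(1), of 1 1]]) (simp_all add: t normal_forms_def)
    qed
  next
    case C0
    note h = h[unfolded C0, simplified]
    note eqs = eqs[unfolded C0, simplified]
    have 0: "l2 = 0" "r2 = 0" using eqs by auto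
    \<comment> \<open>A nonzero square lies on one of the lines through \<open>e\<close> and
      \<open>n\<close>: the characters are nonzero on \<open>e\<close> in the first case and zero in
      the second.\<close>
    consider "u3 \<noteq> 0" | "u3 = 0" "u2 \<noteq> 0" | "u2 = 0" "u3 = 0" by blast
    then show ?thesis
    proof cases
      case 1
      then have "l3 = 1" "r3 = -1" "u2 = 0" using eqs by (auto simp: eq_neg_iff_add_eq_0)
      note h = h[unfolded this 0]
      obtain t where t: "t \<noteq> 0" "t * t * u3 = -1" using exists_square_scaling[OF 1, of "-1"] by auto
      show ?thesis
        by (rule goal[OF has_constants_rescale[OF bil h t(1), of 1 "-1"]]) (simp_all add: t normal_forms_def)
    next
      case 2
      then have "l3 = 0" "r3 = 0" using eqs by auto
      note h = h[unfolded this 0 2(1)]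
      obtain t where t: "t \<noteq> 0" "t * t * u2 = 1" using exists_square_scaling[OF 2(2), of 1] by auto
      show ?thesis
        by (rule goal[OF has_constants_rescale[OF bil h t(1), of 1 1]]) (simp_all add: t normal_forms_def)
    next
      case 3
      have l: "l3 = 0 \<or> l3 = 1" using eqs by auto
      have "(r3 + 1) * r3 = 0" using eqs by (simp add: distrib_right eq_neg_iff_add_eq_0 add.commute)
      then have r: "r3 = 0 \<or> r3 = -1" by (auto simp: add_eq_0_iff2)
      have "[0, 0, 0, r3, 0, l3, 0, 0, 0, 0, 0, 0, 0, 1] \<in> set normal_forms"
        using l r by (elim disjE) (simp_all add: normal_forms_def)
      then show ?thesis using goal[OF h] unfolding 3 0 by blast
    qed
  next
    case left
    note h = h[unfolded left, simplified]
    note eqs = eqs[unfolded left, simplified]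
    \<comment> \<open>The square is annihilated by \<open>n\<close>, so it is a multiple of
      \<open>n\<close>. There left and right multiplication by \<open>e\<close> have eigenvalues 1
      and 0, while a nonzero square needs both equal to \<open>l3 = - r3\<close>. The case
      \<open>right\<close> is the mirror image.\<close>
    have 0: "l2 = 0" "r2 = 0" "u2 = 0" "u3 = 0" using eqs by (auto simp: add_eq_0_iff2)
    have l: "l3 = 0 \<or> l3 = 1" using eqs by auto
    have "(r3 + 1) * r3 = 0" using eqs by (simp add: distrib_right eq_neg_iff_add_eq_0 add.commute)
    then have r: "r3 = 0 \<or> r3 = -1" by (auto simp: add_eq_0_iff2)
    have "[0, 0, 0, r3, 0, l3, 0, 0, 0, 0, 1, 0, 0, 1] \<in> set normal_forms"
      using l r by (elim disjE) (simp_all add: normal_forms_def)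
    then show ?thesis using goal[OF h] unfolding 0 by blast
  next
    case right
    note h = h[unfolded right, simplified]
    note eqs = eqs[unfolded right, simplified]
    have 0: "l2 = 0" "r2 = 0" "u2 = 0" "u3 = 0" using eqs by (auto simp: add_eq_0_iff2)
    have l: "l3 = 0 \<or> l3 = 1" using eqs by auto
    have "(r3 + 1) * r3 = 0" using eqs by (simp add: distrib_right eq_neg_iff_add_eq_0 add.commute)
    then have r: "r3 = 0 \<or> r3 = -1" by (auto simp: add_eq_0_iff2)
    have "[0, 0, 0, r3, 0, l3, 0, 0, 1, 0, 0, 0, 0, 1] \<in> set normal_forms"
      using l r by (elim disjE) (simp_all add: normal_forms_def)
    then show ?thesis using goal[OF h] unfolding 0 by blast
  next
    case nil
    note h = h[unfolded nil, simplified]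
    note eqs = eqs[unfolded nil, simplified]
    \<comment> \<open>Characters of a nilpotent algebra vanish, so \<open>e\<close> annihilates the
      square of \<open>\<theta>\<close>, which must then lie on the line through
      \<open>n = e e\<close>.\<close>
    have 0: "l2 = 0" "r2 = 0" "l3 = 0" "r3 = 0" "u3 = 0" using eqs by auto
    note h = h[unfolded 0]
    show ?thesis
    proof (cases "u2 = 0")
      case True
      have "[0, 0, 0, 0, 0, 0, 0, 0, 0, 0, 0, 0, 1, 0] \<in> set normal_forms" by (simp add: normal_forms_def)
      then show ?thesis using goal[OF h] unfolding True by blast
    next
      case False
      obtain t where t: "t \<noteq> 0" "t * t * u2 = 1" using exists_square_scaling[OF False, of 1] by auto
      show ?thesis
        by (rule goal[OF has_constants_rescale[OF bil h t(1), of 1 1]]) (simp_all add: t normal_forms_def)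
    qed
  next
    case null
    note h = h[unfolded null, simplified]
    note eqs = eqs[unfolded null, simplified]
    have 0: "l2 = 0" "r2 = 0" "l3 = 0" "r3 = 0" using eqs by auto
    note h = h[unfolded 0]
    \<comment> \<open>All products inside \<open>V 1\<close> vanish, so the square of
      \<open>\<theta>\<close> may itself be taken as first basis vector; the swap below covers
      \<open>u2 = 0\<close>.\<close>
    have *: ?thesis if h: "has_constants d \<theta> n e [u2, u3, 0, 0, 0, 0, 0, 0, 0, 0, 0, 0, 0, 0]" "u2 \<noteq> 0" for \<theta> n e u2 u3
    proof -
      have "pair_basis (V 1) (u2 *s n + u3 *s e) (0 *s n + 1 *s e)"
        by (rule pair_basis_transform[OF subspace_V]) (use that in \<open>auto simp: has_constants_def\<close>)
      then have "has_constants d \<theta> (u2 *s n + u3 *s e) e [1, 0, 0, 0, 0, 0, 0, 0, 0, 0, 0, 0, 0, 0]"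
        using h(1) by (simp add: has_constants_def bilinear_op_simps[OF bil])
      then show ?thesis by (rule goal) (simp add: normal_forms_def)
    qed
    consider "u2 \<noteq> 0" | "u3 \<noteq> 0" | "u2 = 0" "u3 = 0" by blast
    then show ?thesis
    proof cases
      case 1 then show ?thesis using *[OF h] by simp
    next
      case 2 then show ?thesis using *[of \<theta> e n u3 u2] has_constants_swap[OF h] by simp
    next
      case 3
      have "d = 0" using zero_table[OF bil h[unfolded 3]] .
      then show ?thesis using \<open>d \<noteq> 0\<close> by contradiction
    qed
  qed
qed

section \<open>Associative algebras\<close>

text \<open>The passage from products to codifferentials with components taken in \<open>V\<close>.
  It is an involution, so the same formula serves for the way back.\<close>

definition twist :: "('v \<Rightarrow> 'v \<Rightarrow> 'v) \<Rightarrow> 'v \<Rightarrow> 'v \<Rightarrow> 'v" where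
  "twist m x y = m (component V 0 x) y - m (component V 1 x) y"

lemma codiff_of_algebra_twist: "parity_rev A = V \<Longrightarrow> codiff_of_algebra A m = twist m"
  unfolding codiff_of_algebra_def twist_def[abs_def] by simp

lemma component_eqI: "a \<in> V p \<Longrightarrow> x - a \<in> V (p + 1) \<Longrightarrow> component V p x = a"
  unfolding component_def
proof (rule the_equality)
  fix b assume a: "a \<in> V p" "x - a \<in> V (p + 1)" and b: "b \<in> V p \<and> x - b \<in> V (p + 1)"
  have "a - b \<in> V p" using a b subspace_V subspace_diff by blast
  moreover have "(x - b) - (x - a) \<in> V (p + 1)" using a b subspace_V subspace_diff by blast
  then have "a - b \<in> V (p + 1)" by simp
  ultimately have "a - b = 0" using V_disjoint[of "a - b"] by (cases p) auto
  then show "b = a" by simp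
qed auto

lemma component_vec: "component V 0 (vec a b c) = vec a 0 0" "component V 1 (vec a b c) = vec 0 b c"
  by (rule component_eqI; simp add: mem_V vec_arith)+

lemma twist_homogeneous:
  assumes "bilinear_op scale m" "x \<in> V p"
  shows "twist m x y = parity_sign p *s m x y"
  using assms(2) bilinear_op_simps(5)[OF assms(1)]
  by (cases p) (auto simp: V_cases(1)[of x] V_cases(2)[of x] twist_def component_vec parity_sign_def vec_0(2)[symmetric])

lemma component_linear: "component V p (x + y) = component V p x + component V p y"
  "component V p (k *s x) = k *s component V p x"
  by (rule vec_cases[of x], rule vec_cases[of y], cases p, simp_all add: component_vec vec_arith)+

lemma bilinear_twist:
  assumes m: "bilinear_op scale m"
  shows "bilinear_op scale (twist m)"
  unfolding bilinear_op_def twist_def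
  by (intro conjI allI linear_intro)
    (simp_all add: bilinear_op_simps[OF m] component_linear scale_right_diff_distrib)

lemma twist_twist:
  assumes m: "bilinear_op scale m"
  shows "twist (twist m) = m"
proof (intro ext)
  fix x y
  obtain a b c where x: "x = vec a b c" by (rule vec_cases)
  have "twist (twist m) x y = m (vec a 0 0) y + m (vec 0 b c) y"
    unfolding twist_def x component_vec using bilinear_op_simps(5)[OF m] by (simp add: vec_0(2)[symmetric])
  also have "\<dots> = m x y" unfolding bilinear_op_simps(1)[OF m, symmetric] by (simp add: x vec_arith)
  finally show "twist (twist m) x y = m x y" .
qed

lemma subspace_sign: "x \<in> V p \<Longrightarrow> parity_sign q *s x \<in> V p"
  using subspace_V subspace_scale by blast

lemma sum_of_homogeneous: obtains a b where "a \<in> V 0" "b \<in> V 1" "x = a + b"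
  using graded unfolding graded_space_def by blast

context
  fixes A assumes A: "parity_rev A = V"
begin

lemma A_eq: "A p = V (p + 1)"
  using A[symmetric] by (cases p) (simp_all add: parity_rev_def)

lemma A_Suc: "A (p + 1) = V p"
  using A[symmetric] by (simp add: parity_rev_def)

text \<open>For \<open>x\<close>, \<open>y\<close> of parities p, q in \<open>V\<close>, the first
  term carries the sign (-1)^p (-1)^(p+q+1) = (-1)^(q+1) and the second (-1)^p (-1)^p (-1)^q =
  (-1)^q, so associativity of \<open>m\<close> makes them cancel.\<close>

lemma odd_codifferential_twist:
  assumes m: "graded_assoc_algebra scale A m"
  shows "odd_codifferential scale V (twist m)"
proof -
  have bil: "bilinear_op scale m" and par: "op_of_parity A 0 m" and assoc: "m (m x y) z = m x (m y z)" for x y z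
    using m unfolding graded_assoc_algebra_def by blast+
  have mV: "m x y \<in> V (p + q + 1)" if "x \<in> V p" "y \<in> V q" for x y p q
  proof -
    have "x \<in> A (p + 1)" "y \<in> A (q + 1)" using that unfolding A_Suc by blast+
    then have "m x y \<in> A (p + 1 + (q + 1) + 0)" using par unfolding op_of_parity_def by blast
    then show ?thesis by (cases p; cases q) (simp_all add: A_eq)
  qed
  note tw = twist_homogeneous[OF bil]
  show ?thesis
    unfolding odd_codifferential_def op_of_parity_def
  proof (intro conjI allI ballI bilinear_twist[OF bil])
    fix p q x y assume "x \<in> V p" "y \<in> V q"
    then show "twist m x y \<in> V (p + q + 1)" unfolding tw[OF \<open>x \<in> V p\<close>] using mV subspace_sign by blast
  next
    fix p q r x y z assume x: "x \<in> V p" and y: "y \<in> V q" and z: "z \<in> V r"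
    show "twist m (twist m x y) z + parity_sign p *s twist m x (twist m y z) = 0"
      unfolding tw[OF x] tw[OF y] tw[OF subspace_sign[OF mV[OF x y]]]
      by (cases p; cases q) (simp_all add: bilinear_op_simps[OF bil] assoc parity_sign_def)
  qed
qed

text \<open>The same signs give associativity on homogeneous triples. The algebra axiom concerns all
  vectors, so each argument is split and the eight homogeneous triples are summed.\<close>

lemma graded_assoc_algebra_twist:
  assumes d: "odd_codifferential scale V d"
  shows "graded_assoc_algebra scale A (twist d)"
proof -
  have bil: "bilinear_op scale d" and par: "op_of_parity V 1 d"
    using d unfolding odd_codifferential_def by blast+
  have co: "d (d x y) z + parity_sign p *s d x (d y z) = 0" if "x \<in> V p" "y \<in> V q" "z \<in> V r" for x y z p q r
    using d that unfolding odd_codifferential_def by blast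
  have dV: "d x y \<in> V (p + q + 1)" if "x \<in> V p" "y \<in> V q" for x y p q
    using par that unfolding op_of_parity_def by blast
  note tw = twist_homogeneous[OF bil]
  have hom: "twist d (twist d x y) z = twist d x (twist d y z)" if x: "x \<in> V p" and y: "y \<in> V q" and z: "z \<in> V r"
    for x y z p q r
  proof -
    have "d (d x y) z = - (parity_sign p *s d x (d y z))"
      using co[OF that] by (simp only: eq_neg_iff_add_eq_0)
    then show ?thesis
      unfolding tw[OF x] tw[OF y] tw[OF subspace_sign[OF dV[OF x y]]]
      by (cases p; cases q) (simp_all add: bilinear_op_simps[OF bil] parity_sign_def)
  qed
  note bt = bilinear_op_simps[OF bilinear_twist[OF bil]]
  show ?thesis
    unfolding graded_assoc_algebra_def op_of_parity_def
  proof (intro conjI allI ballI bilinear_twist[OF bil])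
    fix p q x y assume "x \<in> A p" "y \<in> A q"
    then have x: "x \<in> V (p + 1)" and y: "y \<in> V (q + 1)" by (simp_all add: A_eq)
    have "p + 1 + (q + 1) + 1 = p + q + 0 + 1" by (cases p; cases q) simp_all
    then show "twist d x y \<in> A (p + q + 0)"
      unfolding tw[OF x] A_eq using subspace_sign[OF dV[OF x y]] by simp
  next
    fix x y z
    obtain x0 x1 where x: "x0 \<in> V 0" "x1 \<in> V 1" "x = x0 + x1" by (rule sum_of_homogeneous)
    obtain y0 y1 where y: "y0 \<in> V 0" "y1 \<in> V 1" "y = y0 + y1" by (rule sum_of_homogeneous)
    obtain z0 z1 where z: "z0 \<in> V 0" "z1 \<in> V 1" "z = z0 + z1" by (rule sum_of_homogeneous)
    show "twist d (twist d x y) z = twist d x (twist d y z)"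
      unfolding x(3) y(3) z(3) bt
      by (simp only: add.assoc add.commute add.left_commute
        hom[OF x(1) y(1) z(1)] hom[OF x(1) y(1) z(2)] hom[OF x(1) y(2) z(1)] hom[OF x(1) y(2) z(2)]
        hom[OF x(2) y(1) z(1)] hom[OF x(2) y(1) z(2)] hom[OF x(2) y(2) z(1)] hom[OF x(2) y(2) z(2)])
  qed
qed

lemma even_automorphism_parity_rev: "even_automorphism scale A g \<longleftrightarrow> even_automorphism scale V g"
  unfolding even_automorphism_def all_bit by (auto simp: A_eq)

text \<open>An even linear map commutes with taking components, hence with the sign on the first
  argument.\<close>

lemma twist_intertwine:
  assumes g: "even_automorphism scale V g" and "\<And>x y. g (m x y) = m' (g x) (g y)"
  shows "g (twist m x y) = twist m' (g x) (g y)"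
proof -
  have lin: "Vector_Spaces.linear scale scale g" and sub: "\<And>p. g ` V p \<subseteq> V p"
    using g unfolding even_automorphism_def by blast+
  note hom = Vector_Spaces.linear.axioms(3)[OF lin]
  have "component V p (g x) = g (component V p x)" for p x
  proof (rule component_eqI)
    obtain a b c where x: "x = vec a b c" by (rule vec_cases)
    have 1: "component V p x \<in> V p" "x - component V p x \<in> V (p + 1)"
      by (cases p; simp add: x component_vec mem_V vec_arith)+
    then show "g (component V p x) \<in> V p" using sub by blast
    have "g x - g (component V p x) = g (x - component V p x)" using module_hom.diff[OF hom] by simp
    then show "g x - g (component V p x) \<in> V (p + 1)" using sub[of "p + 1"] 1(2) by (metis image_subset_iff)
  qed
  then show ?thesis unfolding twist_def by (simp add: module_hom.diff[OF hom] assms(2))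
qed

text \<open>The order is reversed: \<open>equivalent_codiff\<close> pulls its first product back
  along \<open>g\<close>, and an isomorphism from \<open>m\<close> to \<open>m'\<close> exhibits
  \<open>m\<close> as a pullback of \<open>m'\<close>. The converse accordingly uses
  \<open>inv g\<close>.\<close>

lemma equivalent_if_isomorphic:
  assumes "isomorphic_algebra scale A m m'"
  shows "equivalent_codiff scale V (twist m') (twist m)"
proof -
  obtain g where g: "even_automorphism scale V g" "\<And>x y. g (m x y) = m' (g x) (g y)"
    using assms unfolding isomorphic_algebra_def even_automorphism_parity_rev by blast
  have "inj g" using g(1) unfolding even_automorphism_def bij_def by blast
  then have "twist m = (\<lambda>x y. inv g (twist m' (g x) (g y)))"
    using inv_f_f[OF \<open>inj g\<close>] by (simp add: twist_intertwine[of g m m', OF g, symmetric])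
  then show ?thesis unfolding equivalent_codiff_def using g(1) by (intro exI[of _ g] conjI)
qed

lemma isomorphic_if_equivalent:
  assumes "bilinear_op scale m" "bilinear_op scale m'" "equivalent_codiff scale V (twist m) (twist m')"
  shows "isomorphic_algebra scale A m m'"
proof -
  obtain g where g: "even_automorphism scale V g" and eq: "twist m' = (\<lambda>x y. inv g (twist m (g x) (g y)))"
    using assms(3) unfolding equivalent_codiff_def by blast
  have bij: "bij g" and lin: "Vector_Spaces.linear scale scale g"
    using g unfolding even_automorphism_def by blast+
  note hom = Vector_Spaces.linear.axioms(3)[OF lin]
  have gi: "g (inv g x) = x" "inv g (g x) = x" for x using bij by (simp_all add: bij_def surj_f_inv_f)
  have "Vector_Spaces.linear scale scale (inv g)"
  proof (rule linear_intro)
    fix x y k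
    show "inv g (x + y) = inv g x + inv g y" by (metis gi module_hom.add[OF hom])
    show "inv g (k *s x) = k *s inv g x" by (metis gi module_hom.scale[OF hom])
  qed
  moreover have "inv g ` V p = V p" for p
    using even_automorphism_image[OF g, of p] bij by (metis bij_is_inj image_inv_f_f)
  ultimately have inv: "even_automorphism scale V (inv g)"
    using bij unfolding even_automorphism_def by (auto simp: bij_imp_bij_inv)
  have "inv g (twist m x y) = twist m' (inv g x) (inv g y)" for x y
    unfolding eq gi ..
  then have "inv g (m x y) = m' (inv g x) (inv g y)" for x y
    using twist_intertwine[OF inv, of "twist m" "twist m'"] assms(1,2) by (simp add: twist_twist)
  then show ?thesis unfolding isomorphic_algebra_def even_automorphism_parity_rev using inv by blast
qed

end

section \<open>The 28 codifferentials and their algebras\<close>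

lemma codiff_index: "i \<in> {1..28} \<Longrightarrow> codiff scale v i = tab (normal_forms ! (i - 1))"
  "i \<in> {1..28} \<Longrightarrow> normal_forms ! (i - 1) \<in> set normal_forms"
  "L \<in> set normal_forms \<Longrightarrow> \<exists>i\<in>{1..28}. codiff scale v i = tab L"
proof -
  have len: "length normal_forms = 28" by (simp add: normal_forms_def)
  show 1: "codiff scale v i = tab (normal_forms ! (i - 1))" if "i \<in> {1..28}" for i
  proof -
    \<comment> \<open>Codifferentials are numbered from 1, list positions from 0.\<close>
    obtain j where "i = Suc j" "j < 28" using \<open>i \<in> {1..28}\<close> by (cases i) auto
    then show ?thesis
      using arg_cong[OF codiff_eq_tab, of "\<lambda>xs. xs ! j"] len by (simp del: upt_rec_numeral)
  qed
  show "i \<in> {1..28} \<Longrightarrow> normal_forms ! (i - 1) \<in> set normal_forms"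
    by (rule nth_mem) (auto simp: len)
  assume "L \<in> set normal_forms"
  then obtain j where "j < 28" "L = normal_forms ! j" by (metis in_set_conv_nth len)
  then show "\<exists>i\<in>{1..28}. codiff scale v i = tab L"
    by (intro bexI[of _ "Suc j"]) (simp_all add: 1)
qed

text \<open>Uniqueness arguments compare invariants through this lemma, in place of symmetry and
  transitivity of equivalence.\<close>

lemma codiff_invariants_inj:
  assumes "i \<in> {1..28}" "j \<in> {1..28}"
    and "invariants (V 0) (V 1) (codiff scale v i) = invariants (V 0) (V 1) (codiff scale v j)"
  shows "i = j"
proof -
  have "length normal_forms = 28" by (simp add: normal_forms_def)
  moreover have "i - 1 < 28" "j - 1 < 28" using assms by auto
  ultimately have "i - 1 = j - 1"
    using assms nth_eq_iff_index_eq[OF distinct_invariants, of "i - 1" "j - 1"] by (simp add: codiff_index)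
  then show ?thesis using assms by auto
qed

lemma odd_codifferential_codiff: "i \<in> {1..28} \<Longrightarrow> odd_codifferential scale V (codiff scale v i)"
  unfolding codiff_index(1) by (rule odd_codifferential_normal_forms[OF codiff_index(2)])

lemma codiff_inequivalent:
  assumes "i \<in> {1..28}" "j \<in> {1..28}" "equivalent_codiff scale V (codiff scale v i) (codiff scale v j)"
  shows "i = j"
  by (rule codiff_invariants_inj[OF assms(1,2) equivalent_invariants[OF assms(3)]])

lemma codiff_classification:
  assumes "odd_codifferential scale V d" "d \<noteq> 0"
  shows "\<exists>!i. i \<in> {1..28} \<and> equivalent_codiff scale V d (codiff scale v i)"
proof -
  obtain L where "L \<in> set normal_forms" and L: "equivalent_codiff scale V d (tab L)"
    using exists_normal_form[OF assms] by blast
  then obtain i where i: "i \<in> {1..28}" "codiff scale v i = tab L" using codiff_index(3) by blast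
  have di: "equivalent_codiff scale V d (codiff scale v i)" using L i by simp
  show ?thesis
  proof (intro ex1I conjI)
    fix j assume j: "j \<in> {1..28} \<and> equivalent_codiff scale V d (codiff scale v j)"
    then have dj: "equivalent_codiff scale V d (codiff scale v j)" by blast
    show "j = i"
      using codiff_invariants_inj[of j i] equivalent_invariants[OF di] equivalent_invariants[OF dj] i j by simp
  qed (use i di in auto)
qed

lemma twist_0: "twist 0 = 0"
  unfolding twist_def fun_eq_iff by simp

text \<open>In every normal form v_1 v_1 has a component along v_2 or v_3 v_3 is nonzero, so two
  evaluations suffice.\<close>

lemma codiff_nonzero:
  assumes "i \<in> {1..28}" shows "codiff scale v i \<noteq> 0"
proof
  define L where "L = normal_forms ! (i - 1)"
  assume "codiff scale v i = 0"
  then have "tab L x y = 0" for x y using codiff_index(1)[OF assms] by (simp add: L_def)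
  then have "tab L (vec 1 0 0) (vec 1 0 0) = 0" "tab L (vec 0 0 1) (vec 0 0 1) = 0" by blast+
  then have "L!0 = 0" "L!12 = 0" "L!13 = 0" by (simp_all add: tab_vec vec_0(1))
  moreover have "\<forall>L\<in>set normal_forms. L!0 \<noteq> 0 \<or> L!12 \<noteq> 0 \<or> L!13 \<noteq> 0"
    by (simp add: normal_forms_def)
  ultimately show False using codiff_index(2)[OF assms] by (auto simp: L_def)
qed

lemma algebra_classification:
  assumes A: "parity_rev A = V"
  shows "\<exists>M. (\<forall>i\<in>{1..28}. graded_assoc_algebra scale A (M i) \<and> M i \<noteq> 0 \<and>
              codiff_of_algebra A (M i) = codiff scale v i) \<and>
           (\<forall>i\<in>{1..28}. \<forall>j\<in>{1..28}. i \<noteq> j \<longrightarrow>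
              \<not> isomorphic_algebra scale A (M i) (M j)) \<and>
           (\<forall>m. graded_assoc_algebra scale A m \<and> m \<noteq> 0 \<longrightarrow>
              (\<exists>!i. i \<in> {1..28::nat} \<and> isomorphic_algebra scale A m (M i)))"
proof (intro exI conjI ballI allI impI)
  \<comment> \<open>Since \<open>twist\<close> is an involution with \<open>twist 0 = 0\<close>,
    these are nonzero products whose codifferentials are the given ones.\<close>
  let ?M = "\<lambda>i. twist (codiff scale v i)"
  have bil: "bilinear_op scale (codiff scale v i)" if "i \<in> {1..28}" for i
    using odd_codifferential_codiff[OF that] unfolding odd_codifferential_def by blast
  fix i :: nat assume i: "i \<in> {1..28}"
  show "graded_assoc_algebra scale A (?M i)"
    using graded_assoc_algebra_twist[OF A odd_codifferential_codiff[OF i]] .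
  show "codiff_of_algebra A (?M i) = codiff scale v i"
    unfolding codiff_of_algebra_twist[OF A] using twist_twist[OF bil[OF i]] .
  show "?M i \<noteq> 0"
    using codiff_nonzero[OF i] twist_twist[OF bil[OF i]] twist_0 by metis
  fix j :: nat assume j: "j \<in> {1..28}" "i \<noteq> j"
  show "\<not> isomorphic_algebra scale A (?M i) (?M j)"
    using equivalent_if_isomorphic[OF A, of "?M i" "?M j"] codiff_inequivalent[OF j(1) i] j(2)
    unfolding twist_twist[OF bil[OF i]] twist_twist[OF bil[OF j(1)]] by blast
next
  let ?M = "\<lambda>i. twist (codiff scale v i)"
  have bil: "bilinear_op scale (codiff scale v i)" if "i \<in> {1..28}" for i
    using odd_codifferential_codiff[OF that] unfolding odd_codifferential_def by blast
  fix m assume m: "graded_assoc_algebra scale A m \<and> m \<noteq> 0"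
  then have bm: "bilinear_op scale m" unfolding graded_assoc_algebra_def by blast
  have "twist m \<noteq> 0" using m twist_twist[OF bm] twist_0 by metis
  then obtain i where i: "i \<in> {1..28}" "equivalent_codiff scale V (twist m) (codiff scale v i)"
    using codiff_classification odd_codifferential_twist[OF A] m by meson
  then have iso: "isomorphic_algebra scale A m (?M i)"
    by (intro isomorphic_if_equivalent[OF A bm bilinear_twist[OF bil]]) (simp_all add: twist_twist bil)
  show "\<exists>!i. i \<in> {1..28} \<and> isomorphic_algebra scale A m (?M i)"
  proof (intro ex1I conjI)
    fix j assume j: "j \<in> {1..28} \<and> isomorphic_algebra scale A m (?M j)"
    then have "equivalent_codiff scale V (codiff scale v j) (twist m)"
      using equivalent_if_isomorphic[OF A, of m "?M j"] twist_twist[OF bil[of j]] by simp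
    from equivalent_invariants[OF this] equivalent_invariants[OF i(2)] show "j = i"
      using codiff_invariants_inj[of j i] i j by simp
  qed (use i iso in auto)
qed

end

theorem mainTheorem1:
  fixes scale :: "complex \<Rightarrow> 'v::ab_group_add \<Rightarrow> 'v"
    and V :: "bit \<Rightarrow> 'v set"
    and v :: "nat \<Rightarrow> 'v"
  assumes "graded_space scale V"
    and "has_graded_dim scale V 1 2"
    and "homogeneous_basis_1_2 scale V v"
  shows
    "(\<forall>i\<in>{1..28}. odd_codifferential scale V (codiff scale v i)) \<and>
     (\<forall>i\<in>{1..28}. \<forall>j\<in>{1..28}. i \<noteq> j \<longrightarrow>
        \<not> equivalent_codiff scale V (codiff scale v i) (codiff scale v j)) \<and>
     (\<forall>d. odd_codifferential scale V d \<and> d \<noteq> 0 \<longrightarrow>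
        (\<exists>!i. i \<in> {1..28} \<and> equivalent_codiff scale V d (codiff scale v i))) \<and>
     (\<forall>A. graded_space scale A \<and> has_graded_dim scale A 2 1 \<and> parity_rev A = V \<longrightarrow>
        (\<exists>M :: nat \<Rightarrow> 'v \<Rightarrow> 'v \<Rightarrow> 'v.
           (\<forall>i\<in>{1..28}. graded_assoc_algebra scale A (M i) \<and> M i \<noteq> 0 \<and>
              codiff_of_algebra A (M i) = codiff scale v i) \<and>
           (\<forall>i\<in>{1..28}. \<forall>j\<in>{1..28}. i \<noteq> j \<longrightarrow>
              \<not> isomorphic_algebra scale A (M i) (M j)) \<and>
           (\<forall>m. graded_assoc_algebra scale A m \<and> m \<noteq> 0 \<longrightarrow>
              (\<exists>!i. i \<in> {1..28} \<and> isomorphic_algebra scale A m (M i)))))"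
proof -
  interpret vector_space scale using assms(1) by (simp add: graded_space_def)
  interpret graded_1_2 scale V v using assms by unfold_locales
  show ?thesis
  proof (intro conjI allI ballI impI)
    fix i :: nat assume i: "i \<in> {1..28}"
    then show "odd_codifferential scale V (codiff scale v i)" by (rule odd_codifferential_codiff)
    fix j :: nat assume "j \<in> {1..28}" "i \<noteq> j"
    then show "\<not> equivalent_codiff scale V (codiff scale v i) (codiff scale v j)"
      using codiff_inequivalent i by blast
  next
    fix d assume "odd_codifferential scale V d \<and> d \<noteq> 0"
    then show "\<exists>!i. i \<in> {1..28} \<and> equivalent_codiff scale V d (codiff scale v i)"
      using codiff_classification by blast
  next
    fix A assume "graded_space scale A \<and> has_graded_dim scale A 2 1 \<and> parity_rev A = V"
    then have "parity_rev A = V" by blast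
    from algebra_classification[OF this]
    show "\<exists>M. (\<forall>i\<in>{1..28}. graded_assoc_algebra scale A (M i) \<and> M i \<noteq> 0 \<and>
              codiff_of_algebra A (M i) = codiff scale v i) \<and>
           (\<forall>i\<in>{1..28}. \<forall>j\<in>{1..28}. i \<noteq> j \<longrightarrow> \<not> isomorphic_algebra scale A (M i) (M j)) \<and>
           (\<forall>m. graded_assoc_algebra scale A m \<and> m \<noteq> 0 \<longrightarrow>
              (\<exists>!i. i \<in> {1..28} \<and> isomorphic_algebra scale A m (M i)))" .
  qed
qed

end
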